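(* Let $G$ be a Lie group which acts on the exact symplectic manifold $(M,\omega=-d\theta)$ leaving the $1$-form $\theta$ invariant, and let $H$ and $f$ be smooth, $G$-invariant functions on $M$. Denote by $J:M\to\mathfrak g^*$ the associated $G$-equivariant momentum map. Then the conformal Hamiltonian vector field $X^f_H$ with Hamiltonian $H$ and conformal parameter $f$ is a $G$-invariant vector field, and its flow preserves the ray pre-images of the associated momentum map as follows: $$J(x(t))=e^{\int_0^t -f(x(s))\,ds}\,J(x(0)),$$ for any integral curve $x$ of $X^f_H$ and any time $t$.
   Context: The momentum map is $\langle J(x),\xi\rangle=\theta(\xi_M)(x)$ for $x\in M$, $\xi\in\mathfrak g$, with $\xi_M$ the infinitesimal generator of $\xi$. A vector field $X^f_H$ on $(M,\omega=-d\theta)$ is conformal Hamiltonian with conformal parameter the smooth function $f$ and smooth Hamiltonian $H$ if $i_{X^f_H}\omega=dH-f\theta$. Ray pre-images are the sets $J^{-1}(\mathbb R^+\mu)$ with $\mathbb R^+\mu=\{r\mu:r>0\}$, $\mu\in\mathfrak g^*$.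
   Formalization: The exponent's sign is corrected: the formula proved is J(x(t)) = e^{∫_0^t f(x(s)) ds} J(x(0)); the printed minus sign fails for M=T*R, θ=p dq, G=R translating q, H=0, f=1, where J=p grows as e^t. *)

theory Defs
  imports "HOL-Analysis.Analysis" "HOL-Algebra.Group_Action"
begin

section \<open>Smooth maps between finite-dimensional normed spaces\<close>

text \<open>Model spaces are finite-dimensional normed spaces rather than Euclidean spaces, because the
  latter have dimension at least one; this way 0-dimensional (discrete) Lie groups are included.\<close>

definition finite_dimensional :: "'e::real_normed_vector itself \<Rightarrow> bool" where
  "finite_dimensional _ \<longleftrightarrow> (\<exists>B::'e set. finite B \<and> span B = UNIV)"

text \<open>Of class $C^k$ on an open set, through iterated directional derivatives (which is the usual
  notion since the domain is finite-dimensional).\<close>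

primrec Ck_on ::
  "nat \<Rightarrow> 'a::real_normed_vector set \<Rightarrow> ('a \<Rightarrow> 'b::real_normed_vector) \<Rightarrow> bool" where
  "Ck_on 0 S h \<longleftrightarrow> continuous_on S h"
| "Ck_on (Suc k) S h \<longleftrightarrow>
     (\<forall>x\<in>S. h differentiable (at x)) \<and> (\<forall>v. Ck_on k S (\<lambda>x. frechet_derivative h (at x) v))"

definition smooth_on ::
  "'a::real_normed_vector set \<Rightarrow> ('a \<Rightarrow> 'b::real_normed_vector) \<Rightarrow> bool" where
  "smooth_on S h \<longleftrightarrow> (\<forall>k. Ck_on k S h)"


section \<open>Smooth manifolds\<close>

type_synonym ('p, 'e) chart = "'p set \<times> ('p \<Rightarrow> 'e)"

record ('p, 'e) manifold =
  mtop :: "'p topology"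
  atlas :: "('p, 'e) chart set"

abbreviation points :: "('p, 'e) manifold \<Rightarrow> 'p set" where
  "points M \<equiv> topspace (mtop M)"

definition chart_inv :: "('p, 'e) chart \<Rightarrow> 'e \<Rightarrow> 'p" where
  "chart_inv c = inv_into (fst c) (snd c)"

definition smooth_manifold :: "('p, 'e::real_normed_vector) manifold \<Rightarrow> bool" where
  "smooth_manifold M \<longleftrightarrow>
     finite_dimensional TYPE('e) \<and>
     Hausdorff_space (mtop M) \<and> second_countable (mtop M) \<and>
     (\<forall>c\<in>atlas M. openin (mtop M) (fst c) \<and> open (snd c ` fst c) \<and>
        homeomorphic_map (subtopology (mtop M) (fst c)) (top_of_set (snd c ` fst c)) (snd c)) \<and>
     (\<Union>c\<in>atlas M. fst c) = points M \<and>
     (\<forall>c\<in>atlas M. \<forall>d\<in>atlas M. smooth_on (snd c ` (fst c \<inter> fst d)) (snd d \<circ> chart_inv c))"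

definition smooth_map ::
  "('p, 'e::real_normed_vector) manifold \<Rightarrow> ('q, 'f::real_normed_vector) manifold \<Rightarrow>
   ('p \<Rightarrow> 'q) \<Rightarrow> bool" where
  "smooth_map M N F \<longleftrightarrow>
     continuous_map (mtop M) (mtop N) F \<and>
     (\<forall>c\<in>atlas M. \<forall>d\<in>atlas N.
        smooth_on (snd c ` {p \<in> fst c. F p \<in> fst d}) (snd d \<circ> F \<circ> chart_inv c))"

definition smooth_fun :: "('p, 'e::real_normed_vector) manifold \<Rightarrow> ('p \<Rightarrow> real) \<Rightarrow> bool" where
  "smooth_fun M h \<longleftrightarrow> (\<forall>c\<in>atlas M. smooth_on (snd c ` fst c) (h \<circ> chart_inv c))"

definition prod_manifold ::
  "('p, 'e) manifold \<Rightarrow> ('q, 'f) manifold \<Rightarrow> ('p \<times> 'q, 'e \<times> 'f) manifold" where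
  "prod_manifold M N =
     \<lparr>mtop = prod_topology (mtop M) (mtop N),
      atlas = {(fst c \<times> fst d, map_prod (snd c) (snd d)) | c d. c \<in> atlas M \<and> d \<in> atlas N}\<rparr>"


section \<open>Tangent vectors\<close>

definition charts_at :: "('p, 'e) manifold \<Rightarrow> 'p \<Rightarrow> ('p, 'e) chart set" where
  "charts_at M p = {c \<in> atlas M. p \<in> fst c}"

definition chart_at :: "('p, 'e) manifold \<Rightarrow> 'p \<Rightarrow> ('p, 'e) chart" where
  "chart_at M p = (SOME c. c \<in> charts_at M p)"

text \<open>A tangent vector at a point assigns to every chart around the point the components of the
  vector in that chart; the components transform by the derivatives of the transition maps.
  To make equality of tangent vectors equality of functions, they vanish on all other charts.\<close>

type_synonym ('p, 'e) tvec = "('p, 'e) chart \<Rightarrow> 'e"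

definition tangent_space ::
  "('p, 'e::real_normed_vector) manifold \<Rightarrow> 'p \<Rightarrow> ('p, 'e) tvec set" where
  "tangent_space M p =
     {v. (\<forall>c\<in>charts_at M p. \<forall>d\<in>charts_at M p.
            v d = frechet_derivative (snd d \<circ> chart_inv c) (at (snd c p)) (v c)) \<and>
         (\<forall>c. c \<notin> charts_at M p \<longrightarrow> v c = 0)}"

definition tlincomb ::
  "real \<Rightarrow> ('p, 'e::real_normed_vector) tvec \<Rightarrow> real \<Rightarrow> ('p, 'e) tvec \<Rightarrow> ('p, 'e) tvec" where
  "tlincomb a u b v = (\<lambda>c. a *\<^sub>R u c + b *\<^sub>R v c)"

definition linear_form_on ::
  "('p, 'e::real_normed_vector) tvec set \<Rightarrow> (('p, 'e) tvec \<Rightarrow> real) \<Rightarrow> bool" where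
  "linear_form_on T \<alpha> \<longleftrightarrow>
     (\<forall>u\<in>T. \<forall>v\<in>T. \<forall>a b. \<alpha> (tlincomb a u b v) = a * \<alpha> u + b * \<alpha> v)"

text \<open>The tangent vector at \<open>p\<close> whose components in the chart \<open>c\<close> are \<open>w\<close>.\<close>

definition coord_tvec ::
  "('p, 'e::real_normed_vector) manifold \<Rightarrow> ('p, 'e) chart \<Rightarrow> 'p \<Rightarrow> 'e \<Rightarrow> ('p, 'e) tvec" where
  "coord_tvec M c p w =
     (\<lambda>d. if d \<in> charts_at M p
          then frechet_derivative (snd d \<circ> chart_inv c) (at (snd c p)) w else 0)"

text \<open>The tangent map of \<open>F\<close> at \<open>p\<close>; by the chain rule, the chart used at \<open>p\<close> is immaterial
  (likewise in the differential and in the exterior derivative below).\<close>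

definition tangent_map ::
  "('p, 'e::real_normed_vector) manifold \<Rightarrow> ('q, 'f::real_normed_vector) manifold \<Rightarrow>
   ('p \<Rightarrow> 'q) \<Rightarrow> 'p \<Rightarrow> ('p, 'e) tvec \<Rightarrow> ('q, 'f) tvec" where
  "tangent_map M N F p v =
     (let c = chart_at M p in
      (\<lambda>d. if d \<in> charts_at N (F p)
           then frechet_derivative (snd d \<circ> F \<circ> chart_inv c) (at (snd c p)) (v c) else 0))"

definition smooth_vector_field ::
  "('p, 'e::real_normed_vector) manifold \<Rightarrow> ('p \<Rightarrow> ('p, 'e) tvec) \<Rightarrow> bool" where
  "smooth_vector_field M X \<longleftrightarrow>
     (\<forall>p\<in>points M. X p \<in> tangent_space M p) \<and>
     (\<forall>c\<in>atlas M. smooth_on (snd c ` fst c) (\<lambda>y. X (chart_inv c y) c))"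

definition integral_curve ::
  "('p, 'e::real_normed_vector) manifold \<Rightarrow> ('p \<Rightarrow> ('p, 'e) tvec) \<Rightarrow> real set \<Rightarrow>
   (real \<Rightarrow> 'p) \<Rightarrow> bool" where
  "integral_curve M X I x \<longleftrightarrow>
     open I \<and> is_interval I \<and> 0 \<in> I \<and>
     continuous_map (top_of_set I) (mtop M) x \<and>
     (\<forall>t\<in>I. \<forall>c\<in>charts_at M (x t). ((snd c \<circ> x) has_vector_derivative X (x t) c) (at t))"


section \<open>Differential forms\<close>

definition smooth_one_form ::
  "('p, 'e::real_normed_vector) manifold \<Rightarrow> ('p \<Rightarrow> ('p, 'e) tvec \<Rightarrow> real) \<Rightarrow> bool" where
  "smooth_one_form M \<theta> \<longleftrightarrow>
     (\<forall>p\<in>points M. linear_form_on (tangent_space M p) (\<theta> p)) \<and>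
     (\<forall>c\<in>atlas M. \<forall>w. smooth_on (snd c ` fst c)
        (\<lambda>y. \<theta> (chart_inv c y) (coord_tvec M c (chart_inv c y) w)))"

definition differential ::
  "('p, 'e::real_normed_vector) manifold \<Rightarrow> ('p \<Rightarrow> real) \<Rightarrow> 'p \<Rightarrow> ('p, 'e) tvec \<Rightarrow> real" where
  "differential M h p v =
     (let c = chart_at M p in frechet_derivative (h \<circ> chart_inv c) (at (snd c p)) (v c))"

text \<open>In a chart, $d\theta(u,v) = \sum_{i,j} (\partial_i \theta_j - \partial_j \theta_i)\, u^i v^j$.\<close>

definition ext_deriv ::
  "('p, 'e::real_normed_vector) manifold \<Rightarrow> ('p \<Rightarrow> ('p, 'e) tvec \<Rightarrow> real) \<Rightarrow>
   'p \<Rightarrow> ('p, 'e) tvec \<Rightarrow> ('p, 'e) tvec \<Rightarrow> real" where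
  "ext_deriv M \<theta> p u v =
     (let c = chart_at M p;
          \<theta>c = (\<lambda>w y. \<theta> (chart_inv c y) (coord_tvec M c (chart_inv c y) w))
      in frechet_derivative (\<theta>c (v c)) (at (snd c p)) (u c)
         - frechet_derivative (\<theta>c (u c)) (at (snd c p)) (v c))"

text \<open>The 2-form $\omega = -d\theta$.\<close>

definition minus_d ::
  "('p, 'e::real_normed_vector) manifold \<Rightarrow> ('p \<Rightarrow> ('p, 'e) tvec \<Rightarrow> real) \<Rightarrow>
   'p \<Rightarrow> ('p, 'e) tvec \<Rightarrow> ('p, 'e) tvec \<Rightarrow> real" where
  "minus_d M \<theta> p u v = - ext_deriv M \<theta> p u v"

definition interior_product ::
  "('p \<Rightarrow> ('p, 'e) tvec) \<Rightarrow> ('p \<Rightarrow> ('p, 'e) tvec \<Rightarrow> ('p, 'e) tvec \<Rightarrow> real) \<Rightarrow>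
   'p \<Rightarrow> ('p, 'e) tvec \<Rightarrow> real" where
  "interior_product X \<omega> p v = \<omega> p (X p) v"

text \<open>Closedness of $\omega = -d\theta$ is automatic, so being symplectic means nondegeneracy.\<close>

definition exact_symplectic_manifold ::
  "('p, 'e::real_normed_vector) manifold \<Rightarrow> ('p \<Rightarrow> ('p, 'e) tvec \<Rightarrow> real) \<Rightarrow> bool" where
  "exact_symplectic_manifold M \<theta> \<longleftrightarrow>
     smooth_manifold M \<and> smooth_one_form M \<theta> \<and>
     (\<forall>p\<in>points M. \<forall>u\<in>tangent_space M p.
        (\<forall>v\<in>tangent_space M p. minus_d M \<theta> p u v = 0) \<longrightarrow> u = (\<lambda>_. 0))"

text \<open>Sign check: on the cotangent bundle of the line with $\theta = p\, dq$, one gets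
  $\omega = dq \wedge dp$ and the equations $q' = \partial H/\partial p$,
  $p' = -\partial H/\partial q + f p$. Hence for translation invariant $H$ and $f$ the momentum
  $J = p$ evolves by the factor $\exp (+\int f)$.\<close>

definition conformal_hamiltonian_field ::
  "('p, 'e::real_normed_vector) manifold \<Rightarrow> ('p \<Rightarrow> ('p, 'e) tvec \<Rightarrow> real) \<Rightarrow>
   ('p \<Rightarrow> real) \<Rightarrow> ('p \<Rightarrow> real) \<Rightarrow> ('p \<Rightarrow> ('p, 'e) tvec) \<Rightarrow> bool" where
  "conformal_hamiltonian_field M \<theta> f H X \<longleftrightarrow>
     smooth_vector_field M X \<and>
     (\<forall>p\<in>points M. \<forall>v\<in>tangent_space M p.
        interior_product X (minus_d M \<theta>) p v = differential M H p v - f p * \<theta> p v)"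


section \<open>Lie group actions\<close>

definition lie_group ::
  "('g, 'z) monoid_scheme \<Rightarrow> ('g, 'k::real_normed_vector) manifold \<Rightarrow> bool" where
  "lie_group G MG \<longleftrightarrow>
     group G \<and> smooth_manifold MG \<and> points MG = carrier G \<and>
     smooth_map (prod_manifold MG MG) MG (\<lambda>(g, h). g \<otimes>\<^bsub>G\<^esub> h) \<and>
     smooth_map MG MG (\<lambda>g. inv\<^bsub>G\<^esub> g)"

definition smooth_action ::
  "('g, 'z) monoid_scheme \<Rightarrow> ('g, 'k::real_normed_vector) manifold \<Rightarrow>
   ('p, 'e::real_normed_vector) manifold \<Rightarrow> ('g \<Rightarrow> 'p \<Rightarrow> 'p) \<Rightarrow> bool" where
  "smooth_action G MG M \<Phi> \<longleftrightarrow>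
     group_action G (points M) \<Phi> \<and>
     smooth_map (prod_manifold MG M) M (\<lambda>(g, p). \<Phi> g p)"

definition invariant_fun ::
  "('g, 'z) monoid_scheme \<Rightarrow> ('p, 'e) manifold \<Rightarrow> ('g \<Rightarrow> 'p \<Rightarrow> 'p) \<Rightarrow>
   ('p \<Rightarrow> real) \<Rightarrow> bool" where
  "invariant_fun G M \<Phi> h \<longleftrightarrow> (\<forall>g\<in>carrier G. \<forall>p\<in>points M. h (\<Phi> g p) = h p)"

definition invariant_one_form ::
  "('g, 'z) monoid_scheme \<Rightarrow> ('p, 'e::real_normed_vector) manifold \<Rightarrow> ('g \<Rightarrow> 'p \<Rightarrow> 'p) \<Rightarrow>
   ('p \<Rightarrow> ('p, 'e) tvec \<Rightarrow> real) \<Rightarrow> bool" where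
  "invariant_one_form G M \<Phi> \<theta> \<longleftrightarrow>
     (\<forall>g\<in>carrier G. \<forall>p\<in>points M. \<forall>v\<in>tangent_space M p.
        \<theta> (\<Phi> g p) (tangent_map M M (\<Phi> g) p v) = \<theta> p v)"

definition invariant_vector_field ::
  "('g, 'z) monoid_scheme \<Rightarrow> ('p, 'e::real_normed_vector) manifold \<Rightarrow> ('g \<Rightarrow> 'p \<Rightarrow> 'p) \<Rightarrow>
   ('p \<Rightarrow> ('p, 'e) tvec) \<Rightarrow> bool" where
  "invariant_vector_field G M \<Phi> X \<longleftrightarrow>
     (\<forall>g\<in>carrier G. \<forall>p\<in>points M. X (\<Phi> g p) = tangent_map M M (\<Phi> g) p (X p))"

abbreviation lie_algebra ::
  "('g, 'z) monoid_scheme \<Rightarrow> ('g, 'k::real_normed_vector) manifold \<Rightarrow> ('g, 'k) tvec set" where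
  "lie_algebra G MG \<equiv> tangent_space MG \<one>\<^bsub>G\<^esub>"

text \<open>$\xi_M(p)$, as the image of $\xi$ under the derivative at the identity of the orbit map
  $g \mapsto g \cdot p$, i.e. $\frac{d}{dt}|_{t=0}\, \exp(t\xi) \cdot p$.\<close>

definition generator ::
  "('g, 'z) monoid_scheme \<Rightarrow> ('g, 'k::real_normed_vector) manifold \<Rightarrow>
   ('p, 'e::real_normed_vector) manifold \<Rightarrow> ('g \<Rightarrow> 'p \<Rightarrow> 'p) \<Rightarrow>
   ('g, 'k) tvec \<Rightarrow> 'p \<Rightarrow> ('p, 'e) tvec" where
  "generator G MG M \<Phi> \<xi> p = tangent_map MG M (\<lambda>g. \<Phi> g p) \<one>\<^bsub>G\<^esub> \<xi>"

text \<open>Elements of the dual of the Lie algebra are linear forms on it, extended by zero outside,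
  so that they are equal and scale as functions.\<close>

definition lie_dual ::
  "('g, 'z) monoid_scheme \<Rightarrow> ('g, 'k::real_normed_vector) manifold \<Rightarrow>
   (('g, 'k) tvec \<Rightarrow> real) set" where
  "lie_dual G MG =
     {\<mu>. linear_form_on (lie_algebra G MG) \<mu> \<and> (\<forall>\<xi>. \<xi> \<notin> lie_algebra G MG \<longrightarrow> \<mu> \<xi> = 0)}"

definition dual_scale :: "real \<Rightarrow> ('v \<Rightarrow> real) \<Rightarrow> 'v \<Rightarrow> real" where
  "dual_scale r \<mu> = (\<lambda>\<xi>. r * \<mu> \<xi>)"

definition momentum_map ::
  "('g, 'z) monoid_scheme \<Rightarrow> ('g, 'k::real_normed_vector) manifold \<Rightarrow>
   ('p, 'e::real_normed_vector) manifold \<Rightarrow> ('g \<Rightarrow> 'p \<Rightarrow> 'p) \<Rightarrow>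
   ('p \<Rightarrow> ('p, 'e) tvec \<Rightarrow> real) \<Rightarrow> 'p \<Rightarrow> ('g, 'k) tvec \<Rightarrow> real" where
  "momentum_map G MG M \<Phi> \<theta> p =
     (\<lambda>\<xi>. if \<xi> \<in> lie_algebra G MG then \<theta> p (generator G MG M \<Phi> \<xi> p) else 0)"

definition ray :: "('v \<Rightarrow> real) \<Rightarrow> ('v \<Rightarrow> real) set" where
  "ray \<mu> = {dual_scale r \<mu> | r. r > 0}"

definition ray_preimage ::
  "('p, 'e) manifold \<Rightarrow> ('p \<Rightarrow> 'v \<Rightarrow> real) \<Rightarrow> ('v \<Rightarrow> real) \<Rightarrow> 'p set" where
  "ray_preimage M J \<mu> = {p \<in> points M. J p \<in> ray \<mu>}"

end

theory Submission
  imports Defs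
begin

text \<open>\<open>X\<close> is invariant because its defining equation is. Each \<open>\<Phi> g\<close> preserves \<open>\<theta>\<close>,
  hence \<open>\<omega> = -d\<theta>\<close> (\<open>ext_deriv_pullback\<close>), and also \<open>H\<close> and \<open>f\<close>. It therefore carries the solution of \<open>i\<^sub>X \<omega> = dH - f \<theta>\<close> at \<open>p\<close> to a solution at \<open>\<Phi> g p\<close>, and
  nondegeneracy of \<open>\<omega>\<close> makes the solution unique.

  For the momentum, invariance of \<open>\<theta>\<close> says \<open>L \<theta> = 0\<close> along the generator \<open>\<xi>\<^sub>M\<close>, so that
  Cartan's formula gives \<open>d(\<theta>(\<xi>\<^sub>M)) = - i d\<theta>\<close> with \<open>\<xi>\<^sub>M\<close> inserted in the first slot
  (\<open>one_form_generator_has_derivative\<close>). Evaluating on \<open>X\<close> yields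
  \<open>d(\<theta>(\<xi>\<^sub>M))(X) = - \<omega>(X, \<xi>\<^sub>M) = f \<theta>(\<xi>\<^sub>M) - dH(\<xi>\<^sub>M) = f \<theta>(\<xi>\<^sub>M)\<close>. Thus each component of \<open>J\<close> solves the
  scalar linear equation \<open>j' = f j\<close> along an integral curve
  (\<open>momentum_has_derivative_along_integral_curve\<close>), and \<open>linear_ode_solution\<close> gives the exponential
  factor. The factor is positive and does not depend on \<open>\<xi>\<close>, so rays are preserved.

  Both derivative computations are done in charts and rest on two facts of calculus:
  the product rule for a pairing that is linear in one argument, which uses that linear coordinates
  on a finite-dimensional normed space are bounded (\<open>has_derivative_linear_pairing\<close>), and the
  symmetry of second derivatives (\<open>second_derivative_symmetric\<close>).\<close>

section \<open>Calculus on finite-dimensional normed spaces\<close>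

text \<open>In a normed space, the coefficients of a vector with respect to finitely many independent
  vectors are bounded by its norm. The induction adds a vector \<open>v\<close> to \<open>B\<close> and needs that \<open>v\<close> has
  positive distance from \<open>span B\<close>: otherwise \<open>v\<close> is a limit of elements of \<open>span B\<close>, whose
  coefficients are Cauchy by the induction hypothesis, so that \<open>v\<close> would lie in \<open>span B\<close>.\<close>

lemma finite_independent_coefficient_bound:
  fixes B :: "'a::real_normed_vector set"
  assumes "finite B" "independent B"
  shows "\<exists>C. \<forall>a. (\<Sum>b\<in>B. \<bar>a b\<bar>) \<le> C * norm (\<Sum>b\<in>B. a b *\<^sub>R b)"
  using assms
proof (induction B)
  case empty
  then show ?case by simp
next
  case (insert v B)
  then have ind: "independent B" and v: "v \<notin> span B"
    by (auto simp: independent_insert split: if_splits)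
  obtain C0 where C0: "(\<Sum>b\<in>B. \<bar>a b\<bar>) \<le> C0 * norm (\<Sum>b\<in>B. a b *\<^sub>R b)" for a
    using insert.IH[OF ind] by blast
  define C where "C = \<bar>C0\<bar>"
  have C: "(\<Sum>b\<in>B. \<bar>a b\<bar>) \<le> C * norm (\<Sum>b\<in>B. a b *\<^sub>R b)" for a
    unfolding C_def by (rule order_trans[OF C0 mult_right_mono]) auto
  have "C \<ge> 0" by (simp add: C_def)
  have "\<exists>\<delta>>0. \<forall>w\<in>span B. norm (v - w) \<ge> \<delta>"
  proof (rule ccontr)
    assume "\<not> ?thesis"
    then have "\<exists>w\<in>span B. norm (v - w) < inverse (real (Suc n))" for n
      by (metis not_le inverse_positive_iff_positive of_nat_0_less_iff zero_less_Suc)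
    then obtain w where w: "\<And>n. w n \<in> span B" "\<And>n. norm (v - w n) < inverse (real (Suc n))"
      by metis
    have "\<forall>n. \<exists>a. w n = (\<Sum>b\<in>B. a b *\<^sub>R b)"
      using w(1) span_finite[OF insert.hyps(1)] by auto
    then obtain a where a: "\<And>n. w n = (\<Sum>b\<in>B. a n b *\<^sub>R b)"
      by metis
    have lim: "w \<longlonglongrightarrow> v"
    proof (rule metric_LIMSEQ_I)
      fix r :: real assume "r > 0"
      then obtain N where N: "inverse (real (Suc N)) < r"
        using reals_Archimedean by blast
      have "dist (w n) v < r" if "n \<ge> N" for n
      proof -
        have "inverse (real (Suc n)) \<le> inverse (real (Suc N))"
          using that by (simp add: field_simps)
        with w(2)[of n] N have "norm (v - w n) < r" by linarith
        then show ?thesis by (simp add: dist_norm norm_minus_commute)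
      qed
      then show "\<exists>no. \<forall>n\<ge>no. dist (w n) v < r" by blast
    qed
    have "convergent (\<lambda>n. a n b)" if b: "b \<in> B" for b
    proof (rule real_Cauchy_convergent, rule metric_CauchyI)
      fix e :: real assume "e > 0"
      have "e / (C + 1) > 0" using \<open>e > 0\<close> \<open>C \<ge> 0\<close> by simp
      then obtain N where N: "\<And>m n. m \<ge> N \<Longrightarrow> n \<ge> N \<Longrightarrow> dist (w m) (w n) < e / (C + 1)"
        using metric_CauchyD[OF LIMSEQ_imp_Cauchy[OF lim]] by blast
      have "dist (a m b) (a n b) < e" if "m \<ge> N" "n \<ge> N" for m n
      proof -
        have "\<bar>a m b - a n b\<bar> \<le> (\<Sum>b\<in>B. \<bar>a m b - a n b\<bar>)"
          using insert.hyps(1) b by (intro member_le_sum) auto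
        also have "\<dots> \<le> C * norm (\<Sum>b\<in>B. (a m b - a n b) *\<^sub>R b)"
          by (rule C)
        also have "(\<Sum>b\<in>B. (a m b - a n b) *\<^sub>R b) = w m - w n"
          by (simp add: a scaleR_left_diff_distrib sum_subtractf)
        also have "C * norm (w m - w n) \<le> C * (e / (C + 1))"
          using N[OF that] \<open>C \<ge> 0\<close> by (intro mult_left_mono) (auto simp: dist_norm)
        also have "\<dots> < e"
          using \<open>e > 0\<close> \<open>C \<ge> 0\<close> by (simp add: field_simps)
        finally show ?thesis by (simp add: dist_real_def)
      qed
      then show "\<exists>M. \<forall>m\<ge>M. \<forall>n\<ge>M. dist (a m b) (a n b) < e" by blast
    qed
    then obtain l where l: "\<And>b. b \<in> B \<Longrightarrow> (\<lambda>n. a n b) \<longlonglongrightarrow> l b"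
      unfolding convergent_def by metis
    have "w \<longlonglongrightarrow> (\<Sum>b\<in>B. l b *\<^sub>R b)"
      unfolding a by (intro tendsto_intros l)
    then have "v = (\<Sum>b\<in>B. l b *\<^sub>R b)"
      using lim LIMSEQ_unique by blast
    moreover have "(\<Sum>b\<in>B. l b *\<^sub>R b) \<in> span B"
      by (intro span_sum span_scale span_base)
    ultimately show False using v by simp
  qed
  then obtain \<delta> where \<delta>: "\<delta> > 0" "\<And>w. w \<in> span B \<Longrightarrow> norm (v - w) \<ge> \<delta>" by blast
  show ?case
  proof (intro exI allI)
    fix a :: "'a \<Rightarrow> real"
    define w where "w = (\<Sum>b\<in>B. a b *\<^sub>R b)"
    define N where "N = norm (a v *\<^sub>R v + w)"
    have wB: "w \<in> span B" unfolding w_def by (intro span_sum span_scale span_base)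
    have 1: "\<bar>a v\<bar> \<le> N / \<delta>"
    proof (cases "a v = 0")
      case False
      have "a v *\<^sub>R v + w = a v *\<^sub>R (v - (- inverse (a v)) *\<^sub>R w)"
        using False by (simp add: scaleR_right_distrib)
      then have "N = \<bar>a v\<bar> * norm (v - (- inverse (a v)) *\<^sub>R w)"
        unfolding N_def by (metis norm_scaleR)
      moreover have "norm (v - (- inverse (a v)) *\<^sub>R w) \<ge> \<delta>"
        by (intro \<delta>(2) span_scale wB)
      ultimately have "\<bar>a v\<bar> * \<delta> \<le> N" by (simp add: mult_left_mono)
      then show ?thesis using \<delta>(1) by (simp add: field_simps)
    qed (use \<delta>(1) in \<open>simp add: N_def\<close>)
    have "norm w \<le> N + norm (a v *\<^sub>R v)"
      unfolding N_def by (metis add_diff_cancel_left' norm_triangle_ineq4)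
    also have "\<dots> \<le> N + N / \<delta> * norm v"
      using mult_right_mono[OF 1, of "norm v"] by simp
    finally have "C * norm w \<le> C * (N + N / \<delta> * norm v)"
      using \<open>C \<ge> 0\<close> by (rule mult_left_mono)
    with C[of a] 1 have "\<bar>a v\<bar> + (\<Sum>b\<in>B. \<bar>a b\<bar>) \<le> N / \<delta> + C * (N + N / \<delta> * norm v)"
      unfolding w_def by linarith
    also have "\<dots> = (1 / \<delta> + C * (1 + norm v / \<delta>)) * N"
      by (simp add: algebra_simps)
    finally show "(\<Sum>b\<in>insert v B. \<bar>a b\<bar>)
        \<le> (1 / \<delta> + C * (1 + norm v / \<delta>)) * norm (\<Sum>b\<in>insert v B. a b *\<^sub>R b)"
      using insert.hyps by (simp add: N_def w_def)
  qed
qed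

lemma finite_dimensional_coordinates:
  assumes "finite_dimensional TYPE('e::real_normed_vector)"
  obtains B :: "'e::real_normed_vector set" and \<phi> :: "'e \<Rightarrow> 'e \<Rightarrow> real"
  where "finite B" "\<And>b. b \<in> B \<Longrightarrow> bounded_linear (\<phi> b)"
    "\<And>w. (\<Sum>b\<in>B. \<phi> b w *\<^sub>R b) = w"
proof -
  obtain A :: "'e set" where A: "finite A" "span A = UNIV"
    using assms unfolding finite_dimensional_def by blast
  obtain B where B: "B \<subseteq> A" "independent B" "A \<subseteq> span B"
    using maximal_independent_subset by blast
  have finB: "finite B" using A(1) B(1) finite_subset by blast
  have spB: "span B = UNIV" using A(2) B(3) by (metis span_minimal subspace_span top.extremum_uniqueI)
  have rep: "(\<Sum>b\<in>B. representation B w b *\<^sub>R b) = w" for w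
    using sum_representation_eq[OF B(2) _ finB] spB by auto
  obtain C where C: "\<And>a. (\<Sum>b\<in>B. \<bar>a b\<bar>) \<le> C * norm (\<Sum>b\<in>B. a b *\<^sub>R b)"
    using finite_independent_coefficient_bound[OF finB B(2)] by blast
  have "bounded_linear (\<lambda>w. representation B w b)" if b: "b \<in> B" for b
  proof (rule bounded_linear_intro[where K = C])
    show "representation B (x + y) b = representation B x b + representation B y b" for x y
      using representation_add[OF B(2)] spB by auto
    show "representation B (r *\<^sub>R x) b = r *\<^sub>R representation B x b" for r x
      using representation_scale[OF B(2)] spB by auto
    fix x
    have "\<bar>representation B x b\<bar> \<le> (\<Sum>b\<in>B. \<bar>representation B x b\<bar>)"
      using finB b by (intro member_le_sum) auto
    also have "\<dots> \<le> C * norm x" using C[of "representation B x"] by (simp add: rep)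
    finally show "norm (representation B x b) \<le> norm x * C" by (simp add: mult.commute)
  qed
  then show ?thesis
    using that[of B "\<lambda>b w. representation B w b"] finB rep by blast
qed

text \<open>Product rule for a family \<open>\<Theta> w y\<close> which is linear in \<open>w\<close> and differentiable in \<open>y\<close> for each
  fixed \<open>w\<close>. Separate differentiability suffices because \<open>\<Theta> w y\<close> is a finite sum of products
  of coordinates of \<open>w\<close> and functions of \<open>y\<close>.\<close>

lemma has_derivative_linear_pairing:
  fixes \<Theta> :: "'e::real_normed_vector \<Rightarrow> 'y::real_normed_vector \<Rightarrow> real"
    and B :: "'z::real_normed_vector \<Rightarrow> 'e"
  assumes fin: "finite_dimensional TYPE('e)"
    and S: "open S" "a z \<in> S"
    and lin: "\<And>y. y \<in> S \<Longrightarrow> linear (\<lambda>w. \<Theta> w y)"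
    and diff: "\<And>w. \<Theta> w differentiable (at (a z))"
    and B: "(B has_derivative B') (at z)"
    and a: "(a has_derivative a') (at z)"
  shows "((\<lambda>x. \<Theta> (B x) (a x)) has_derivative
           (\<lambda>\<zeta>. frechet_derivative (\<Theta> (B z)) (at (a z)) (a' \<zeta>) + \<Theta> (B' \<zeta>) (a z))) (at z)"
proof -
  obtain I :: "'e set" and \<phi> :: "'e \<Rightarrow> 'e \<Rightarrow> real" where I: "finite I"
    "\<And>b. b \<in> I \<Longrightarrow> bounded_linear (\<phi> b)" "\<And>w. (\<Sum>b\<in>I. \<phi> b w *\<^sub>R b) = w"
    using finite_dimensional_coordinates[OF fin] by blast
  have expand: "\<Theta> w y = (\<Sum>b\<in>I. \<phi> b w * \<Theta> b y)" if "y \<in> S" for w y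
  proof -
    interpret linear "\<lambda>w. \<Theta> w y" by (rule lin[OF that])
    show ?thesis by (subst I(3)[of w, symmetric]) (simp add: sum scale)
  qed
  have d\<Theta>: "(\<Theta> w has_derivative frechet_derivative (\<Theta> w) (at (a z))) (at (a z))" for w
    using diff frechet_derivative_works by blast
  have dw: "frechet_derivative (\<Theta> w) (at (a z)) =
      (\<lambda>\<eta>. \<Sum>b\<in>I. \<phi> b w * frechet_derivative (\<Theta> b) (at (a z)) \<eta>)" for w
  proof -
    have "((\<lambda>y. \<Sum>b\<in>I. \<phi> b w * \<Theta> b y) has_derivative
        (\<lambda>\<eta>. \<Sum>b\<in>I. \<phi> b w * frechet_derivative (\<Theta> b) (at (a z)) \<eta>)) (at (a z))"
      by (intro has_derivative_sum has_derivative_mult_right d\<Theta>)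
    then have "(\<Theta> w has_derivative
        (\<lambda>\<eta>. \<Sum>b\<in>I. \<phi> b w * frechet_derivative (\<Theta> b) (at (a z)) \<eta>)) (at (a z))"
      by (rule has_derivative_transform_within_open[OF _ S]) (simp add: expand[symmetric])
    then show ?thesis using frechet_derivative_at by metis
  qed
  have da: "((\<lambda>x. \<Theta> b (a x)) has_derivative
      (\<lambda>\<zeta>. frechet_derivative (\<Theta> b) (at (a z)) (a' \<zeta>))) (at z)" for b
    using has_derivative_compose[OF a d\<Theta>] .
  have dB: "((\<lambda>x. \<phi> b (B x)) has_derivative (\<lambda>\<zeta>. \<phi> b (B' \<zeta>))) (at z)" if "b \<in> I" for b
    by (rule bounded_linear.has_derivative[OF I(2)[OF that] B])
  have "((\<lambda>x. \<Sum>b\<in>I. \<phi> b (B x) * \<Theta> b (a x)) has_derivative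
      (\<lambda>\<zeta>. \<Sum>b\<in>I. \<phi> b (B z) * frechet_derivative (\<Theta> b) (at (a z)) (a' \<zeta>)
            + \<phi> b (B' \<zeta>) * \<Theta> b (a z))) (at z)"
    by (intro has_derivative_sum has_derivative_mult da dB)
  moreover have "\<Theta> (B' \<zeta>) (a z) = (\<Sum>b\<in>I. \<phi> b (B' \<zeta>) * \<Theta> b (a z))" for \<zeta>
    by (rule expand[OF S(2)])
  ultimately have *: "((\<lambda>x. \<Sum>b\<in>I. \<phi> b (B x) * \<Theta> b (a x)) has_derivative
      (\<lambda>\<zeta>. frechet_derivative (\<Theta> (B z)) (at (a z)) (a' \<zeta>) + \<Theta> (B' \<zeta>) (a z))) (at z)"
    by (simp only: dw[of "B z"] sum.distrib)
  have "continuous (at z) a" using a has_derivative_continuous by blast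
  then have "\<forall>\<^sub>F x in at z. a x \<in> S"
    using S by (simp add: continuous_at tendsto_def)
  then have ev: "\<forall>\<^sub>F x in at z. (\<Sum>b\<in>I. \<phi> b (B x) * \<Theta> b (a x)) = \<Theta> (B x) (a x)"
    by eventually_elim (simp add: expand[symmetric])
  show ?thesis
    by (rule has_derivative_transform_eventually[OF * ev]) (use S(2) in \<open>simp_all add: expand[symmetric]\<close>)
qed

lemma Ck_on_cong:
  assumes "open S" "\<And>x. x \<in> S \<Longrightarrow> h x = k x"
  shows "Ck_on n S h \<longleftrightarrow> Ck_on n S k"
proof -
  have "Ck_on n S k" if "Ck_on n S h" "\<And>x. x \<in> S \<Longrightarrow> h x = k x" for h k :: "'a \<Rightarrow> 'b"
    using that
  proof (induction n arbitrary: h k)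
    case 0
    have "continuous_on S h = continuous_on S k"
      by (rule continuous_on_cong[OF refl 0(2)])
    then show ?case using 0(1) by simp
  next
    case (Suc n)
    have d: "(k has_derivative frechet_derivative h (at x)) (at x)" if x: "x \<in> S" for x
    proof (rule has_derivative_transform_within_open[OF _ assms(1) x Suc.prems(2)])
      show "(h has_derivative frechet_derivative h (at x)) (at x)"
        using Suc.prems(1) x frechet_derivative_works by auto
    qed
    have "Ck_on n S (\<lambda>x. frechet_derivative k (at x) v)" for v
    proof (rule Suc.IH)
      show "Ck_on n S (\<lambda>x. frechet_derivative h (at x) v)" using Suc.prems(1) by simp
      show "frechet_derivative h (at x) v = frechet_derivative k (at x) v" if "x \<in> S" for x
        using fun_cong[OF frechet_derivative_at[OF d[OF that]]] .
    qed
    moreover have "k differentiable (at x)" if "x \<in> S" for x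
      using d[OF that] by (rule differentiableI)
    ultimately show ?case by simp
  qed
  from this[of h k] this[of k h] show ?thesis using assms(2) by auto
qed

lemma smooth_on_cong:
  assumes "open S" "smooth_on S h" "\<And>x. x \<in> S \<Longrightarrow> h x = k x"
  shows "smooth_on S k"
  using Ck_on_cong[OF assms(1,3)] assms(2) unfolding smooth_on_def by simp

lemma Ck_on_compose_affine:
  assumes "open S" "bounded_linear L" "Ck_on n S h"
  shows "Ck_on n {y. a + L y \<in> S} (\<lambda>y. h (a + L y))"
  using assms(3)
proof (induction n arbitrary: h)
  case 0
  have "continuous_on {y. a + L y \<in> S} (\<lambda>y. a + L y)"
    by (intro continuous_intros linear_continuous_on assms)
  then show ?case
    using 0 continuous_on_compose2[of S h _ "\<lambda>y. a + L y"] by auto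
next
  case (Suc n)
  let ?T = "{y. a + L y \<in> S}"
  have dL: "((\<lambda>y. a + L y) has_derivative L) (at y)" for y
    using bounded_linear_imp_has_derivative[OF assms(2)]
    by (auto intro!: derivative_eq_intros)
  have opn: "open ?T"
    using open_vimage[OF assms(1), of "\<lambda>y. a + L y"]
    by (simp add: vimage_def continuous_on_add linear_continuous_on assms(2))
  have d: "((\<lambda>y. h (a + L y)) has_derivative
      (\<lambda>v. frechet_derivative h (at (a + L y)) (L v))) (at y)" if "y \<in> ?T" for y
  proof (rule has_derivative_compose[OF dL])
    show "(h has_derivative frechet_derivative h (at (a + L y))) (at (a + L y))"
      using that Suc.prems frechet_derivative_works by auto
  qed
  then have fd: "frechet_derivative (\<lambda>y. h (a + L y)) (at y) =
      (\<lambda>v. frechet_derivative h (at (a + L y)) (L v))" if "y \<in> ?T" for y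
    using that frechet_derivative_at by metis
  have "Ck_on n ?T (\<lambda>y. frechet_derivative (\<lambda>y. h (a + L y)) (at y) v)" for v
  proof -
    have "Ck_on n ?T (\<lambda>y. frechet_derivative h (at (a + L y)) (L v))"
      using Suc.IH[of "\<lambda>x. frechet_derivative h (at x) (L v)"] Suc.prems by simp
    then show ?thesis
      by (subst Ck_on_cong[OF opn]) (auto simp: fd)
  qed
  moreover have "(\<lambda>y. h (a + L y)) differentiable (at y)" if "y \<in> ?T" for y
    using d[OF that] by (rule differentiableI)
  ultimately show ?case by simp
qed

lemma smooth_on_compose_affine:
  assumes "open S" "bounded_linear L" "smooth_on S h"
  shows "smooth_on {y. a + L y \<in> S} (\<lambda>y. h (a + L y))"
  using assms Ck_on_compose_affine unfolding smooth_on_def by blast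

lemma smooth_on_has_derivative:
  assumes "smooth_on S h" "x \<in> S"
  shows "(h has_derivative frechet_derivative h (at x)) (at x)"
  using assms unfolding smooth_on_def by (metis Ck_on.simps(2) frechet_derivative_works)

lemma smooth_on_directional_derivative:
  assumes "smooth_on S h"
  shows "smooth_on S (\<lambda>x. frechet_derivative h (at x) v)"
  using assms unfolding smooth_on_def by (metis Ck_on.simps(2))

text \<open>The symmetric second difference of \<open>h\<close> along \<open>u\<close> and \<open>v\<close> converges to the derivative in
  direction \<open>v\<close> of the directional derivative along \<open>u\<close>. Only differentiability of \<open>y \<mapsto> D y u\<close> at
  \<open>x\<close> is needed, and the mean value inequality allows any normed space as codomain.\<close>

lemma second_difference_quotient:
  fixes h :: "'a::real_normed_vector \<Rightarrow> 'b::real_normed_vector"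
  assumes S: "open S" "x \<in> S"
    and d: "\<And>y. y \<in> S \<Longrightarrow> (h has_derivative D y) (at y)"
    and P: "((\<lambda>y. D y u) has_derivative P) (at x)"
  shows "((\<lambda>s. (h (x + s *\<^sub>R u + s *\<^sub>R v) - h (x + s *\<^sub>R u) - h (x + s *\<^sub>R v) + h x) /\<^sub>R s\<^sup>2)
           \<longlongrightarrow> P v) (at_right 0)"
proof (rule tendstoI)
  fix e0 :: real assume "e0 > 0"
  define e where "e = e0 / 2"
  have "e > 0" using \<open>e0 > 0\<close> by (simp add: e_def)
  interpret P: bounded_linear P using P has_derivative_bounded_linear by blast
  define K where "K = 2 * norm u + norm v + 1"
  have "K > 0" unfolding K_def by (simp add: add_nonneg_pos)
  have "e / (2 * K) > 0" using \<open>e > 0\<close> \<open>K > 0\<close> by simp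
  then obtain r1 where r1: "r1 > 0" and rem:
    "\<And>y. norm (y - x) < r1 \<Longrightarrow> norm (D y u - D x u - P (y - x)) \<le> e / (2 * K) * norm (y - x)"
    using P unfolding has_derivative_at_alt by blast
  obtain r2 where r2: "r2 > 0" "ball x r2 \<subseteq> S"
    using S open_contains_ball by blast
  define r where "r = min r1 r2 / K"
  have "r > 0" using r1 r2 \<open>K > 0\<close> by (simp add: r_def)
  have key: "norm ((h (x + s *\<^sub>R u + s *\<^sub>R v) - h (x + s *\<^sub>R u) - h (x + s *\<^sub>R v) + h x) /\<^sub>R s\<^sup>2 - P v)
      \<le> e" if s: "0 < s" "s < r" for s
  proof -
    have sK: "s * K < min r1 r2" using s \<open>K > 0\<close> unfolding r_def by (simp add: field_simps)
    have small: "norm (\<tau> *\<^sub>R u + \<sigma> *\<^sub>R v) < min r1 r2" "norm (\<tau> *\<^sub>R u + \<sigma> *\<^sub>R v) \<le> s * K"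
      if "\<tau> \<in> {0..s}" "\<sigma> \<in> {0..s}" for \<tau> \<sigma>
    proof -
      have "norm (\<tau> *\<^sub>R u + \<sigma> *\<^sub>R v) \<le> \<tau> * norm u + \<sigma> * norm v"
        using that norm_triangle_ineq[of "\<tau> *\<^sub>R u" "\<sigma> *\<^sub>R v"] by auto
      also have "\<dots> \<le> s * norm u + s * norm v"
        using that by (intro add_mono mult_right_mono) auto
      also have "\<dots> \<le> s * K" using s by (simp add: K_def algebra_simps)
      finally show "norm (\<tau> *\<^sub>R u + \<sigma> *\<^sub>R v) \<le> s * K" .
      with sK show "norm (\<tau> *\<^sub>R u + \<sigma> *\<^sub>R v) < min r1 r2" by linarith
    qed
    have inS: "x + \<tau> *\<^sub>R u + \<sigma> *\<^sub>R v \<in> S" if "\<tau> \<in> {0..s}" "\<sigma> \<in> {0..s}" for \<tau> \<sigma>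
    proof -
      have "dist x (x + (\<tau> *\<^sub>R u + \<sigma> *\<^sub>R v)) = norm (\<tau> *\<^sub>R u + \<sigma> *\<^sub>R v)"
        unfolding dist_norm by (metis add_diff_cancel_left' norm_minus_commute)
      then have "x + (\<tau> *\<^sub>R u + \<sigma> *\<^sub>R v) \<in> ball x r2"
        using small(1)[OF that] by simp
      then show ?thesis using r2 by (auto simp: add.assoc)
    qed
    \<comment> \<open>\<open>\<psi> s - \<psi> 0\<close> is the second difference minus the expected value \<open>s\<^sup>2 P v\<close>.\<close>
    define \<psi> where "\<psi> = (\<lambda>\<tau>. h (x + \<tau> *\<^sub>R u + s *\<^sub>R v) - h (x + \<tau> *\<^sub>R u) - \<tau> *\<^sub>R (s *\<^sub>R P v))"
    define \<psi>' where "\<psi>' = (\<lambda>\<tau>. D (x + \<tau> *\<^sub>R u + s *\<^sub>R v) u - D (x + \<tau> *\<^sub>R u) u - s *\<^sub>R P v)"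
    have dh: "((\<lambda>\<tau>. h (x + \<tau> *\<^sub>R u + \<sigma> *\<^sub>R v)) has_derivative
        (\<lambda>t. t *\<^sub>R D (x + \<tau> *\<^sub>R u + \<sigma> *\<^sub>R v) u)) (at \<tau>)"
      if "\<tau> \<in> {0..s}" "\<sigma> \<in> {0..s}" for \<tau> \<sigma>
    proof -
      have l: "((\<lambda>\<tau>. x + \<tau> *\<^sub>R u + \<sigma> *\<^sub>R v) has_derivative (\<lambda>t. t *\<^sub>R u)) (at \<tau>)"
        by (auto intro!: derivative_eq_intros)
      interpret Dl: bounded_linear "D (x + \<tau> *\<^sub>R u + \<sigma> *\<^sub>R v)"
        using d[OF inS[OF that]] has_derivative_bounded_linear by blast
      show ?thesis
        using has_derivative_compose[OF l d[OF inS[OF that]]] by (simp add: Dl.scale)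
    qed
    have d\<psi>: "(\<psi> has_derivative (\<lambda>t. t *\<^sub>R \<psi>' \<tau>)) (at \<tau> within {0..s})" if "\<tau> \<in> {0..s}" for \<tau>
    proof -
      have "((\<lambda>\<tau>. \<tau> *\<^sub>R (s *\<^sub>R P v)) has_derivative (\<lambda>t. t *\<^sub>R (s *\<^sub>R P v))) (at \<tau>)"
        by (rule bounded_linear_imp_has_derivative[OF bounded_linear_scaleR_left])
      from has_derivative_diff[OF has_derivative_diff[OF dh[OF that, of s] dh[OF that, of 0]] this]
      have "(\<psi> has_derivative (\<lambda>t. t *\<^sub>R \<psi>' \<tau>)) (at \<tau>)"
        using s by (simp add: \<psi>_def \<psi>'_def scaleR_right_diff_distrib)
      then show ?thesis by (rule has_derivative_at_withinI)
    qed
    have bd: "norm (\<psi>' \<tau>) \<le> e * s" if "\<tau> \<in> {0..s}" for \<tau>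
    proof -
      have R: "norm (D (x + (\<tau> *\<^sub>R u + \<sigma> *\<^sub>R v)) u - D x u - P (\<tau> *\<^sub>R u + \<sigma> *\<^sub>R v)) \<le> e / 2 * s"
        if "\<sigma> \<in> {0..s}" for \<sigma>
      proof -
        have "norm (D (x + (\<tau> *\<^sub>R u + \<sigma> *\<^sub>R v)) u - D x u - P (\<tau> *\<^sub>R u + \<sigma> *\<^sub>R v))
            \<le> e / (2 * K) * norm (\<tau> *\<^sub>R u + \<sigma> *\<^sub>R v)"
          using rem[of "x + (\<tau> *\<^sub>R u + \<sigma> *\<^sub>R v)"] small(1)[OF \<open>\<tau> \<in> _\<close> that] by simp
        also have "\<dots> \<le> e / (2 * K) * (s * K)"
          using small(2)[OF \<open>\<tau> \<in> _\<close> that] \<open>e > 0\<close> \<open>K > 0\<close> by (intro mult_left_mono) auto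
        also have "\<dots> = e / 2 * s" using \<open>K > 0\<close> by simp
        finally show ?thesis .
      qed
      have "\<psi>' \<tau> = (D (x + (\<tau> *\<^sub>R u + s *\<^sub>R v)) u - D x u - P (\<tau> *\<^sub>R u + s *\<^sub>R v))
          - (D (x + (\<tau> *\<^sub>R u + 0 *\<^sub>R v)) u - D x u - P (\<tau> *\<^sub>R u + 0 *\<^sub>R v))"
        by (simp add: \<psi>'_def P.add P.scale add.assoc)
      also have "norm \<dots> \<le> e / 2 * s + e / 2 * s"
        using s by (intro norm_triangle_le_diff add_mono R) auto
      finally show ?thesis by simp
    qed
    have "norm (\<psi> s - \<psi> 0) \<le> e * s * norm (s - 0)"
    proof (rule differentiable_bound[OF _ d\<psi>])
      show "onorm (\<lambda>t. t *\<^sub>R \<psi>' \<tau>) \<le> e * s" if "\<tau> \<in> {0..s}" for \<tau>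
        using bd[OF that] by (intro onorm_le) (simp add: mult.commute mult_left_mono)
    qed (use s in auto)
    then have "norm (\<psi> s - \<psi> 0) \<le> e * s\<^sup>2" using s by (simp add: power2_eq_square)
    moreover have "(h (x + s *\<^sub>R u + s *\<^sub>R v) - h (x + s *\<^sub>R u) - h (x + s *\<^sub>R v) + h x) /\<^sub>R s\<^sup>2 - P v
        = (\<psi> s - \<psi> 0) /\<^sub>R s\<^sup>2"
    proof -
      have "\<psi> s - \<psi> 0 = h (x + s *\<^sub>R u + s *\<^sub>R v) - h (x + s *\<^sub>R u) - h (x + s *\<^sub>R v) + h x - s\<^sup>2 *\<^sub>R P v"
        by (simp add: \<psi>_def power2_eq_square algebra_simps)
      then show ?thesis using s by (simp add: scaleR_right_diff_distrib)
    qed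
    ultimately show ?thesis
      using s by (simp add: divide_simps mult.commute)
  qed
  show "\<forall>\<^sub>F s in at_right 0. dist ((h (x + s *\<^sub>R u + s *\<^sub>R v) - h (x + s *\<^sub>R u) - h (x + s *\<^sub>R v) + h x) /\<^sub>R s\<^sup>2)
      (P v) < e0"
    using eventually_at_right_real[OF \<open>r > 0\<close>]
  proof eventually_elim
    case (elim s)
    then show ?case
      using key[of s] \<open>e0 > 0\<close> unfolding e_def dist_norm by auto
  qed
qed

text \<open>Schwarz's theorem: the second difference does not change when \<open>u\<close> and \<open>v\<close> are swapped.\<close>

lemma second_derivative_symmetric:
  fixes h :: "'a::real_normed_vector \<Rightarrow> 'b::real_normed_vector"
  assumes S: "open S" "x \<in> S"
    and d: "\<And>y. y \<in> S \<Longrightarrow> (h has_derivative D y) (at y)"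
    and P: "((\<lambda>y. D y u) has_derivative P) (at x)"
    and Q: "((\<lambda>y. D y v) has_derivative Q) (at x)"
  shows "P v = Q u"
proof (rule tendsto_unique)
  show "((\<lambda>s. (h (x + s *\<^sub>R u + s *\<^sub>R v) - h (x + s *\<^sub>R u) - h (x + s *\<^sub>R v) + h x) /\<^sub>R s\<^sup>2)
           \<longlongrightarrow> P v) (at_right 0)"
    by (rule second_difference_quotient[OF S d P])
  show "((\<lambda>s. (h (x + s *\<^sub>R u + s *\<^sub>R v) - h (x + s *\<^sub>R u) - h (x + s *\<^sub>R v) + h x) /\<^sub>R s\<^sup>2)
           \<longlongrightarrow> Q u) (at_right 0)"
    using second_difference_quotient[OF S d Q, of u] by (simp add: algebra_simps)
qed simp

section \<open>Charts and smooth maps\<close>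

lemma charts_atD:
  assumes "c \<in> charts_at M p"
  shows "c \<in> atlas M" "p \<in> fst c"
  using assms by (auto simp: charts_at_def)

lemma chart_facts:
  assumes "smooth_manifold M" "c \<in> atlas M"
  shows openin_chart_domain: "openin (mtop M) (fst c)"
    and open_chart_range: "open (snd c ` fst c)"
    and chart_domain_subset: "fst c \<subseteq> points M"
    and homeomorphic_map_chart:
      "homeomorphic_map (subtopology (mtop M) (fst c)) (top_of_set (snd c ` fst c)) (snd c)"
    and inj_on_chart: "inj_on (snd c) (fst c)"
proof -
  show 1: "openin (mtop M) (fst c)" and "open (snd c ` fst c)"
    and 2: "homeomorphic_map (subtopology (mtop M) (fst c)) (top_of_set (snd c ` fst c)) (snd c)"
    using assms unfolding smooth_manifold_def by auto
  show 3: "fst c \<subseteq> points M" using 1 openin_subset by blast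
  show "inj_on (snd c) (fst c)"
    using homeomorphic_imp_injective_map[OF 2] 3 by (simp add: Int_absorb1)
qed

lemma chart_inv_in:
  assumes "y \<in> snd c ` fst c"
  shows "chart_inv c y \<in> fst c" "snd c (chart_inv c y) = y"
  using assms unfolding chart_inv_def by (auto intro: inv_into_into f_inv_into_f)

lemma chart_inv_chart:
  assumes "smooth_manifold M" "c \<in> atlas M" "p \<in> fst c"
  shows "chart_inv c (snd c p) = p"
  unfolding chart_inv_def using inj_on_chart[OF assms(1,2)] assms(3) by (rule inv_into_f_f)

lemma open_chart_image:
  assumes M: "smooth_manifold M" "c \<in> atlas M" and U: "openin (mtop M) U"
  shows "open (snd c ` (fst c \<inter> U))"
proof -
  have "openin (subtopology (mtop M) (fst c)) (fst c \<inter> U)"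
    using U by (auto simp: openin_subtopology)
  then have "openin (top_of_set (snd c ` fst c)) (snd c ` (fst c \<inter> U))"
    using homeomorphic_imp_open_map[OF homeomorphic_map_chart[OF M]]
    by (simp add: open_map_def)
  then show ?thesis
    using openin_open_trans[OF _ open_chart_range[OF M]] by simp
qed

lemma continuous_map_chart_inv:
  assumes M: "smooth_manifold M" "c \<in> atlas M"
  shows "continuous_map (top_of_set (snd c ` fst c)) (mtop M) (chart_inv c)"
proof -
  have top: "topspace (subtopology (mtop M) (fst c)) = fst c"
    using chart_domain_subset[OF M] by (simp add: Int_absorb1)
  obtain g where g: "homeomorphic_maps (subtopology (mtop M) (fst c)) (top_of_set (snd c ` fst c)) (snd c) g"
    using homeomorphic_map_chart[OF M] homeomorphic_map_maps by blast
  have cont: "continuous_map (top_of_set (snd c ` fst c)) (mtop M) g"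
    using g unfolding homeomorphic_maps_def by (simp add: continuous_map_in_subtopology)
  have "g y = chart_inv c y" if y: "y \<in> snd c ` fst c" for y
  proof -
    obtain p where p: "p \<in> fst c" "y = snd c p" using y by blast
    then have "g (snd c p) = p" using g top unfolding homeomorphic_maps_def by auto
    then show ?thesis using p chart_inv_chart[OF M] by simp
  qed
  then show ?thesis by (intro continuous_map_eq[OF cont]) auto
qed

lemma chart_at_in:
  assumes "smooth_manifold M" "p \<in> points M"
  shows "chart_at M p \<in> charts_at M p"
proof -
  have "\<exists>c. c \<in> charts_at M p"
    using assms unfolding smooth_manifold_def charts_at_def by blast
  then show ?thesis unfolding chart_at_def by (rule someI_ex)
qed

lemma chart_point_in_range:
  assumes "c \<in> charts_at M p"
  shows "snd c p \<in> snd c ` fst c"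
  using charts_atD(2)[OF assms] by blast

lemma smooth_map_local:
  assumes M: "smooth_manifold M" and N: "smooth_manifold N" and F: "smooth_map M N F"
    and c: "c \<in> atlas M" and d: "d \<in> atlas N"
  shows "open (snd c ` {p \<in> fst c. F p \<in> fst d})"
    and "smooth_on (snd c ` {p \<in> fst c. F p \<in> fst d}) (snd d \<circ> F \<circ> chart_inv c)"
proof -
  have "openin (mtop M) {p \<in> points M. F p \<in> fst d}"
    using F openin_chart_domain[OF N d] unfolding smooth_map_def
    by (blast intro: openin_continuous_map_preimage)
  then have "open (snd c ` (fst c \<inter> {p \<in> points M. F p \<in> fst d}))"
    by (rule open_chart_image[OF M c])
  moreover have "fst c \<inter> {p \<in> points M. F p \<in> fst d} = {p \<in> fst c. F p \<in> fst d}"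
    using chart_domain_subset[OF M c] by blast
  ultimately show "open (snd c ` {p \<in> fst c. F p \<in> fst d})" by simp
  show "smooth_on (snd c ` {p \<in> fst c. F p \<in> fst d}) (snd d \<circ> F \<circ> chart_inv c)"
    using F c d unfolding smooth_map_def by blast
qed

lemma smooth_map_has_derivative:
  assumes M: "smooth_manifold M" and N: "smooth_manifold N" and F: "smooth_map M N F"
    and c: "c \<in> charts_at M p" and d: "d \<in> charts_at N (F p)"
  shows "((snd d \<circ> F \<circ> chart_inv c) has_derivative
           frechet_derivative (snd d \<circ> F \<circ> chart_inv c) (at (snd c p))) (at (snd c p))"
  using smooth_on_has_derivative[OF smooth_map_local(2)[OF M N F charts_atD(1)[OF c] charts_atD(1)[OF d]]]
    charts_atD(2)[OF c] charts_atD(2)[OF d] by blast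

lemma smooth_map_id:
  assumes "smooth_manifold M"
  shows "smooth_map M M id"
  using assms unfolding smooth_map_def smooth_manifold_def by (auto simp: Int_def)

lemma smooth_map_in_points:
  assumes "smooth_map M N F" "p \<in> points M"
  shows "F p \<in> points N"
  using assms unfolding smooth_map_def continuous_map_def by auto

lemma charts_at_points:
  assumes "smooth_manifold M" "c \<in> charts_at M p"
  shows "p \<in> points M"
  using chart_domain_subset[OF assms(1) charts_atD(1)[OF assms(2)]] charts_atD(2)[OF assms(2)] by blast

text \<open>The composite is only required to agree with \<open>K\<close> on the manifold, so that \<open>K\<close> can be \<open>id\<close>
  when \<open>G\<close> is only there a left inverse of \<open>F\<close>.\<close>

lemma chart_chain_rule:
  assumes M: "smooth_manifold M" and N: "smooth_manifold N" and L: "smooth_manifold L"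
    and F: "smooth_map M N F" and G: "smooth_map N L G"
    and FG: "\<And>q. q \<in> points M \<Longrightarrow> K q = G (F q)"
    and c: "c \<in> charts_at M p" and m: "m \<in> charts_at N (F p)" and d: "d \<in> charts_at L (G (F p))"
  shows "frechet_derivative (snd d \<circ> K \<circ> chart_inv c) (at (snd c p)) =
    frechet_derivative (snd d \<circ> G \<circ> chart_inv m) (at (snd m (F p))) \<circ>
    frechet_derivative (snd m \<circ> F \<circ> chart_inv c) (at (snd c p))"
proof -
  let ?f = "snd m \<circ> F \<circ> chart_inv c" and ?g = "snd d \<circ> G \<circ> chart_inv m"
  let ?D = "snd c ` {p \<in> fst c. F p \<in> fst m}"
  have p: "chart_inv c (snd c p) = p"
    using chart_inv_chart[OF M] charts_atD[OF c] by blast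
  have 1: "(?f has_derivative frechet_derivative ?f (at (snd c p))) (at (snd c p))"
    by (rule smooth_map_has_derivative[OF M N F c m])
  have "(?g has_derivative frechet_derivative ?g (at (snd m (F p)))) (at (?f (snd c p)))"
    using smooth_map_has_derivative[OF N L G m d] p by simp
  from diff_chain_at[OF 1 this]
  have "(?g \<circ> ?f has_derivative
     frechet_derivative ?g (at (snd m (F p))) \<circ> frechet_derivative ?f (at (snd c p))) (at (snd c p))" .
  then have "(snd d \<circ> K \<circ> chart_inv c has_derivative
     frechet_derivative ?g (at (snd m (F p))) \<circ> frechet_derivative ?f (at (snd c p))) (at (snd c p))"
  proof (rule has_derivative_transform_within_open)
    show "open ?D" by (rule smooth_map_local(1)[OF M N F charts_atD(1)[OF c] charts_atD(1)[OF m]])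
    show "snd c p \<in> ?D" using charts_atD(2)[OF c] charts_atD(2)[OF m] by blast
    fix y assume "y \<in> ?D"
    then obtain q where q: "q \<in> fst c" "F q \<in> fst m" "y = snd c q" by blast
    then have "chart_inv c y = q" "chart_inv m (snd m (F q)) = F q" "q \<in> points M"
      using chart_inv_chart[OF M charts_atD(1)[OF c]] chart_inv_chart[OF N charts_atD(1)[OF m]]
        chart_domain_subset[OF M charts_atD(1)[OF c]] by auto
    then show "(?g \<circ> ?f) y = (snd d \<circ> K \<circ> chart_inv c) y" by (simp add: FG)
  qed
  then show ?thesis using frechet_derivative_at by metis
qed

lemma transition_chain_rule:
  assumes M: "smooth_manifold M"
    and c: "c \<in> charts_at M p" and m: "m \<in> charts_at M p" and d: "d \<in> charts_at M p"
  shows "frechet_derivative (snd d \<circ> chart_inv c) (at (snd c p)) =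
    frechet_derivative (snd d \<circ> chart_inv m) (at (snd m p)) \<circ>
    frechet_derivative (snd m \<circ> chart_inv c) (at (snd c p))"
  using chart_chain_rule[OF M M M smooth_map_id[OF M] smooth_map_id[OF M], of id c p m d] c m d
  by simp

lemma transition_has_derivative:
  assumes M: "smooth_manifold M" and c: "c \<in> charts_at M p" and d: "d \<in> charts_at M p"
  shows "((snd d \<circ> chart_inv c) has_derivative
    frechet_derivative (snd d \<circ> chart_inv c) (at (snd c p))) (at (snd c p))"
  using smooth_map_has_derivative[OF M M smooth_map_id[OF M], of c p d] c d by simp

lemma transition_self:
  assumes M: "smooth_manifold M" and c: "c \<in> charts_at M p"
  shows "frechet_derivative (snd c \<circ> chart_inv c) (at (snd c p)) = id"
proof -
  have "(id has_derivative id) (at (snd c p))" by (simp add: id_def)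
  then have "(snd c \<circ> chart_inv c has_derivative id) (at (snd c p))"
    by (rule has_derivative_transform_within_open[OF _ open_chart_range[OF M charts_atD(1)[OF c]]
          chart_point_in_range[OF c]]) (simp add: chart_inv_in)
  then show ?thesis using frechet_derivative_at by metis
qed

text \<open>A smooth map on a product, in terms of charts of the two factors.\<close>

lemma smooth_map_prod_local:
  assumes N: "smooth_manifold N" and M: "smooth_manifold M" and L: "smooth_manifold L"
    and F: "smooth_map (prod_manifold N M) L F"
    and k: "k \<in> atlas N" and c: "c \<in> atlas M" and d: "d \<in> atlas L"
  defines "W \<equiv> {z \<in> (snd k ` fst k) \<times> (snd c ` fst c).
      F (chart_inv k (fst z), chart_inv c (snd z)) \<in> fst d}"
  shows "open W"
    and "smooth_on W (\<lambda>z. snd d (F (chart_inv k (fst z), chart_inv c (snd z))))"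
proof -
  let ?R = "(snd k ` fst k) \<times> (snd c ` fst c)"
  let ?e = "(fst k \<times> fst c, map_prod (snd k) (snd c))"
  let ?i = "\<lambda>z. (chart_inv k (fst z), chart_inv c (snd z))"
  have "continuous_map (top_of_set ?R) (top_of_set (snd k ` fst k)) fst"
    "continuous_map (top_of_set ?R) (top_of_set (snd c ` fst c)) snd"
    by (auto intro!: continuous_intros)
  from continuous_map_compose[OF this(1) continuous_map_chart_inv[OF N k]]
    continuous_map_compose[OF this(2) continuous_map_chart_inv[OF M c]]
  have "continuous_map (top_of_set ?R) (prod_topology (mtop N) (mtop M)) ?i"
    by (intro continuous_map_pairedI) (simp_all add: o_def)
  moreover have "continuous_map (prod_topology (mtop N) (mtop M)) (mtop L) F"
    using F by (simp add: smooth_map_def prod_manifold_def)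
  ultimately have "continuous_map (top_of_set ?R) (mtop L) (F \<circ> ?i)"
    by (rule continuous_map_compose)
  then have "openin (top_of_set ?R) {z \<in> topspace (top_of_set ?R). (F \<circ> ?i) z \<in> fst d}"
    by (rule openin_continuous_map_preimage[OF _ openin_chart_domain[OF L d]])
  moreover have "open ?R" by (intro open_Times open_chart_range[OF N k] open_chart_range[OF M c])
  ultimately show W: "open W" using openin_open_trans by (auto simp: W_def)
  have inj: "inj_on (map_prod (snd k) (snd c)) (fst k \<times> fst c)"
    by (intro map_prod_inj_on inj_on_chart[OF N k] inj_on_chart[OF M c])
  have e_inv: "chart_inv ?e (snd k p, snd c q) = (p, q)" if "p \<in> fst k" "q \<in> fst c" for p q
    using inv_into_f_f[OF inj, of "(p, q)"] that by (simp add: chart_inv_def)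
  have We: "W = snd ?e ` {p \<in> fst ?e. F p \<in> fst d}"
  proof (intro equalityI subsetI)
    fix z assume z: "z \<in> W"
    then have "z = snd ?e (?i z)" "?i z \<in> {p \<in> fst ?e. F p \<in> fst d}"
      using chart_inv_chart[OF N k] chart_inv_chart[OF M c] unfolding W_def by auto
    then show "z \<in> snd ?e ` {p \<in> fst ?e. F p \<in> fst d}" by blast
  next
    fix z assume "z \<in> snd ?e ` {p \<in> fst ?e. F p \<in> fst d}"
    then show "z \<in> W"
      using chart_inv_chart[OF N k] chart_inv_chart[OF M c] unfolding W_def by auto
  qed
  have "?e \<in> atlas (prod_manifold N M)" using k c unfolding prod_manifold_def manifold.simps by blast
  then have "smooth_on W (snd d \<circ> F \<circ> chart_inv ?e)"
    unfolding We using F d unfolding smooth_map_def by blast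
  moreover have "(snd d \<circ> F \<circ> chart_inv ?e) z = snd d (F (?i z))" if zW: "z \<in> W" for z
  proof -
    obtain p q where "p \<in> fst k" "q \<in> fst c" "z = (snd k p, snd c q)"
      using zW unfolding W_def by auto
    then show ?thesis
      using e_inv chart_inv_chart[OF N k] chart_inv_chart[OF M c] by simp
  qed
  ultimately show "smooth_on W (\<lambda>z. snd d (F (?i z)))"
    by (rule smooth_on_cong[OF W])
qed

lemma smooth_map_slice_left:
  assumes N: "smooth_manifold N" and M: "smooth_manifold M" and L: "smooth_manifold L"
    and F: "smooth_map (prod_manifold N M) L F" and p: "p \<in> points M"
  shows "smooth_map N L (\<lambda>n. F (n, p))"
  unfolding smooth_map_def
proof (intro conjI ballI)
  have "continuous_map (mtop N) (prod_topology (mtop N) (mtop M)) (\<lambda>n. (n, p))"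
    using p by (intro continuous_map_pairedI) auto
  then show "continuous_map (mtop N) (mtop L) (\<lambda>n. F (n, p))"
    using continuous_map_compose F unfolding smooth_map_def prod_manifold_def by (fastforce simp: o_def)
next
  fix k d assume k: "k \<in> atlas N" and d: "d \<in> atlas L"
  define c where "c = chart_at M p"
  have c: "c \<in> charts_at M p" unfolding c_def by (rule chart_at_in[OF M p])
  note W = smooth_map_prod_local[OF N M L F k charts_atD(1)[OF c] d]
  let ?W = "{z \<in> (snd k ` fst k) \<times> (snd c ` fst c).
      F (chart_inv k (fst z), chart_inv c (snd z)) \<in> fst d}"
  have "bounded_linear (\<lambda>x. (x, 0))" by (intro bounded_linear_Pair bounded_linear_ident bounded_linear_zero)
  from smooth_on_compose_affine[OF W(1) this W(2), of "(0, snd c p)"]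
  have S: "smooth_on {x. (x, snd c p) \<in> ?W} (\<lambda>x. snd d (F (chart_inv k x, p)))"
    using chart_inv_chart[OF M charts_atD[OF c]] by simp
  have "{x. (x, snd c p) \<in> ?W} = snd k ` {n \<in> fst k. F (n, p) \<in> fst d}"
  proof (intro equalityI subsetI)
    fix x assume "x \<in> {x. (x, snd c p) \<in> ?W}"
    then have "x = snd k (chart_inv k x)" "chart_inv k x \<in> {n \<in> fst k. F (n, p) \<in> fst d}"
      using chart_inv_chart[OF N k] chart_inv_chart[OF M charts_atD[OF c]] by auto
    then show "x \<in> snd k ` {n \<in> fst k. F (n, p) \<in> fst d}" by (rule image_eqI)
  next
    fix x assume "x \<in> snd k ` {n \<in> fst k. F (n, p) \<in> fst d}"
    then show "x \<in> {x. (x, snd c p) \<in> ?W}"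
      using chart_inv_chart[OF N k] chart_inv_chart[OF M charts_atD[OF c]] charts_atD(2)[OF c] by auto
  qed
  then show "smooth_on (snd k ` {n \<in> fst k. F (n, p) \<in> fst d}) (snd d \<circ> (\<lambda>n. F (n, p)) \<circ> chart_inv k)"
    using S by (simp add: o_def)
qed

lemma smooth_map_slice_right:
  assumes N: "smooth_manifold N" and M: "smooth_manifold M" and L: "smooth_manifold L"
    and F: "smooth_map (prod_manifold N M) L F" and n: "n \<in> points N"
  shows "smooth_map M L (\<lambda>p. F (n, p))"
  unfolding smooth_map_def
proof (intro conjI ballI)
  have "continuous_map (mtop M) (prod_topology (mtop N) (mtop M)) (\<lambda>p. (n, p))"
    using n by (intro continuous_map_pairedI) auto
  then show "continuous_map (mtop M) (mtop L) (\<lambda>p. F (n, p))"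
    using continuous_map_compose F unfolding smooth_map_def prod_manifold_def by (fastforce simp: o_def)
next
  fix c d assume c: "c \<in> atlas M" and d: "d \<in> atlas L"
  define k where "k = chart_at N n"
  have k: "k \<in> charts_at N n" unfolding k_def by (rule chart_at_in[OF N n])
  note W = smooth_map_prod_local[OF N M L F charts_atD(1)[OF k] c d]
  let ?W = "{z \<in> (snd k ` fst k) \<times> (snd c ` fst c).
      F (chart_inv k (fst z), chart_inv c (snd z)) \<in> fst d}"
  have "bounded_linear (\<lambda>x. (0, x))" by (intro bounded_linear_Pair bounded_linear_ident bounded_linear_zero)
  from smooth_on_compose_affine[OF W(1) this W(2), of "(snd k n, 0)"]
  have S: "smooth_on {x. (snd k n, x) \<in> ?W} (\<lambda>x. snd d (F (n, chart_inv c x)))"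
    using chart_inv_chart[OF N charts_atD[OF k]] by simp
  have "{x. (snd k n, x) \<in> ?W} = snd c ` {p \<in> fst c. F (n, p) \<in> fst d}"
  proof (intro equalityI subsetI)
    fix x assume "x \<in> {x. (snd k n, x) \<in> ?W}"
    then have "x = snd c (chart_inv c x)" "chart_inv c x \<in> {p \<in> fst c. F (n, p) \<in> fst d}"
      using chart_inv_chart[OF M c] chart_inv_chart[OF N charts_atD[OF k]] by auto
    then show "x \<in> snd c ` {p \<in> fst c. F (n, p) \<in> fst d}" by (rule image_eqI)
  next
    fix x assume "x \<in> snd c ` {p \<in> fst c. F (n, p) \<in> fst d}"
    then show "x \<in> {x. (snd k n, x) \<in> ?W}"
      using chart_inv_chart[OF M c] chart_inv_chart[OF N charts_atD[OF k]] charts_atD(2)[OF k] by auto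
  qed
  then show "smooth_on (snd c ` {p \<in> fst c. F (n, p) \<in> fst d}) (snd d \<circ> (\<lambda>p. F (n, p)) \<circ> chart_inv c)"
    using S by (simp add: o_def)
qed

section \<open>Tangent spaces and tangent maps\<close>

lemma tangent_space_transform:
  assumes "v \<in> tangent_space M p" "c \<in> charts_at M p" "d \<in> charts_at M p"
  shows "v d = frechet_derivative (snd d \<circ> chart_inv c) (at (snd c p)) (v c)"
  using assms unfolding tangent_space_def by blast

lemma tangent_space_outside:
  assumes "v \<in> tangent_space M p" "c \<notin> charts_at M p"
  shows "v c = 0"
  using assms unfolding tangent_space_def by blast

lemma tangent_space_eqI:
  assumes "u \<in> tangent_space M p" "v \<in> tangent_space M p" "c \<in> charts_at M p" "u c = v c"
  shows "u = v"
proof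
  fix d show "u d = v d"
  proof (cases "d \<in> charts_at M p")
    case True
    show ?thesis
      unfolding tangent_space_transform[OF assms(1,3) True]
        tangent_space_transform[OF assms(2,3) True] assms(4) ..
  next
    case False
    show ?thesis
      using tangent_space_outside[OF assms(1) False] tangent_space_outside[OF assms(2) False] by simp
  qed
qed

lemma coord_tvec_tangent:
  assumes M: "smooth_manifold M" and c: "c \<in> charts_at M p"
  shows "coord_tvec M c p w \<in> tangent_space M p"
  unfolding tangent_space_def
proof (intro CollectI conjI ballI allI impI)
  fix m d assume m: "m \<in> charts_at M p" and d: "d \<in> charts_at M p"
  show "coord_tvec M c p w d =
      frechet_derivative (snd d \<circ> chart_inv m) (at (snd m p)) (coord_tvec M c p w m)"
    using fun_cong[OF transition_chain_rule[OF M c m d], of w] m d by (simp add: coord_tvec_def)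
qed (simp add: coord_tvec_def)

lemma coord_tvec_self:
  assumes M: "smooth_manifold M" and c: "c \<in> charts_at M p"
  shows "coord_tvec M c p w c = w"
  using transition_self[OF M c] c by (simp add: coord_tvec_def)

lemma coord_tvec_component:
  assumes M: "smooth_manifold M" and c: "c \<in> charts_at M p" and v: "v \<in> tangent_space M p"
  shows "coord_tvec M c p (v c) = v"
  by (rule tangent_space_eqI[OF coord_tvec_tangent[OF M c] v c coord_tvec_self[OF M c]])

lemma coord_tvec_lincomb:
  assumes M: "smooth_manifold M" and c: "c \<in> charts_at M p"
  shows "coord_tvec M c p (a *\<^sub>R u + b *\<^sub>R w) =
    tlincomb a (coord_tvec M c p u) b (coord_tvec M c p w)"
proof
  fix d
  show "coord_tvec M c p (a *\<^sub>R u + b *\<^sub>R w) d =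
    tlincomb a (coord_tvec M c p u) b (coord_tvec M c p w) d"
  proof (cases "d \<in> charts_at M p")
    case True
    interpret linear "frechet_derivative (snd d \<circ> chart_inv c) (at (snd c p))"
      using transition_has_derivative[OF M c True] has_derivative_linear by blast
    show ?thesis using True by (simp add: coord_tvec_def tlincomb_def add scale)
  qed (simp add: coord_tvec_def tlincomb_def)
qed

lemma tlincomb_tangent:
  assumes M: "smooth_manifold M" and u: "u \<in> tangent_space M p" and v: "v \<in> tangent_space M p"
  shows "tlincomb a u b v \<in> tangent_space M p"
  unfolding tangent_space_def tlincomb_def
proof (intro CollectI conjI ballI allI impI)
  fix c d assume c: "c \<in> charts_at M p" and d: "d \<in> charts_at M p"
  interpret linear "frechet_derivative (snd d \<circ> chart_inv c) (at (snd c p))"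
    using transition_has_derivative[OF M c d] has_derivative_linear by blast
  show "a *\<^sub>R u d + b *\<^sub>R v d =
      frechet_derivative (snd d \<circ> chart_inv c) (at (snd c p)) (a *\<^sub>R u c + b *\<^sub>R v c)"
    using tangent_space_transform[OF u c d] tangent_space_transform[OF v c d]
    by (simp add: add scale)
next
  fix c assume "c \<notin> charts_at M p"
  then show "a *\<^sub>R u c + b *\<^sub>R v c = 0"
    using tangent_space_outside[OF u] tangent_space_outside[OF v] by simp
qed

text \<open>Independence of the tangent map of the chart used at the base point.\<close>

lemma tangent_map_component:
  assumes M: "smooth_manifold M" and N: "smooth_manifold N" and F: "smooth_map M N F"
    and v: "v \<in> tangent_space M p" and c: "c \<in> charts_at M p" and d: "d \<in> charts_at N (F p)"
  shows "tangent_map M N F p v d =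
    frechet_derivative (snd d \<circ> F \<circ> chart_inv c) (at (snd c p)) (v c)"
proof -
  have c0: "chart_at M p \<in> charts_at M p"
    by (rule chart_at_in[OF M charts_at_points[OF M c]])
  have "frechet_derivative (snd d \<circ> F \<circ> chart_inv (chart_at M p)) (at (snd (chart_at M p) p)) =
    frechet_derivative (snd d \<circ> F \<circ> chart_inv c) (at (snd c p)) \<circ>
    frechet_derivative (snd c \<circ> chart_inv (chart_at M p)) (at (snd (chart_at M p) p))"
    using chart_chain_rule[OF M M N smooth_map_id[OF M] F _ c0, of F c d] c d by simp
  then show ?thesis
    using tangent_space_transform[OF v c0 c] d by (simp add: tangent_map_def Let_def)
qed

lemma tangent_map_tangent:
  assumes M: "smooth_manifold M" and N: "smooth_manifold N" and F: "smooth_map M N F"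
    and p: "p \<in> points M"
  shows "tangent_map M N F p v \<in> tangent_space N (F p)"
proof -
  have c0: "chart_at M p \<in> charts_at M p" by (rule chart_at_in[OF M p])
  have "frechet_derivative (snd d' \<circ> F \<circ> chart_inv (chart_at M p)) (at (snd (chart_at M p) p)) =
    frechet_derivative (snd d' \<circ> chart_inv d) (at (snd d (F p))) \<circ>
    frechet_derivative (snd d \<circ> F \<circ> chart_inv (chart_at M p)) (at (snd (chart_at M p) p))"
    if "d \<in> charts_at N (F p)" "d' \<in> charts_at N (F p)" for d d'
    using chart_chain_rule[OF M N N F smooth_map_id[OF N] _ c0, of F d d'] that by simp
  note * = fun_cong[OF this]
  show ?thesis
    unfolding tangent_space_def
  proof (intro CollectI conjI ballI allI impI)
    fix d d' assume d: "d \<in> charts_at N (F p)" and d': "d' \<in> charts_at N (F p)"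
    show "tangent_map M N F p v d' =
        frechet_derivative (snd d' \<circ> chart_inv d) (at (snd d (F p))) (tangent_map M N F p v d)"
      using *[OF d d', of "v (chart_at M p)"] d d' by (simp add: tangent_map_def Let_def)
  qed (simp add: tangent_map_def Let_def)
qed

lemma tangent_map_left_inverse:
  assumes M: "smooth_manifold M" and N: "smooth_manifold N"
    and F: "smooth_map M N F" and G: "smooth_map N M G"
    and GF: "\<And>q. q \<in> points M \<Longrightarrow> G (F q) = q"
    and p: "p \<in> points M" and v: "v \<in> tangent_space M p"
  shows "tangent_map N M G (F p) (tangent_map M N F p v) = v"
proof -
  define c where "c = chart_at M p"
  define m where "m = chart_at N (F p)"
  have c: "c \<in> charts_at M p" unfolding c_def by (rule chart_at_in[OF M p])
  have Fp: "F p \<in> points N" by (rule smooth_map_in_points[OF F p])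
  have m: "m \<in> charts_at N (F p)" unfolding m_def by (rule chart_at_in[OF N Fp])
  have Tv: "tangent_map M N F p v \<in> tangent_space N (F p)" by (rule tangent_map_tangent[OF M N F p])
  have c': "c \<in> charts_at M (G (F p))" using c GF[OF p] by simp
  have "frechet_derivative (snd c \<circ> G \<circ> chart_inv m) (at (snd m (F p))) \<circ>
    frechet_derivative (snd m \<circ> F \<circ> chart_inv c) (at (snd c p)) = id"
    using chart_chain_rule[OF M N M F G _ c m c', of id] transition_self[OF M c] GF by simp
  then have "tangent_map N M G (F p) (tangent_map M N F p v) c = v c"
    using tangent_map_component[OF N M G Tv m c'] tangent_map_component[OF M N F v c m]
    by (simp add: fun_eq_iff)
  moreover have "tangent_map N M G (F p) (tangent_map M N F p v) \<in> tangent_space M p"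
    using tangent_map_tangent[OF N M G Fp] GF[OF p] by simp
  ultimately show ?thesis by (intro tangent_space_eqI[OF _ v c])
qed

section \<open>One-forms and exterior derivatives\<close>

text \<open>The coordinate expression of a one-form in a chart \<open>c\<close>: its value at the point with coordinates
  \<open>y\<close>, on the tangent vector there with components \<open>w\<close>. The vector comes first because the
  derivatives are taken in \<open>y\<close> for fixed \<open>w\<close>.\<close>

definition form_in_chart ::
  "('p, 'e::real_normed_vector) manifold \<Rightarrow> ('p \<Rightarrow> ('p, 'e) tvec \<Rightarrow> real) \<Rightarrow> ('p, 'e) chart \<Rightarrow>
   'e \<Rightarrow> 'e \<Rightarrow> real" where
  "form_in_chart M \<theta> c w y = \<theta> (chart_inv c y) (coord_tvec M c (chart_inv c y) w)"

lemma chart_inv_charts_at: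
  assumes "c \<in> atlas M" "y \<in> snd c ` fst c"
  shows "c \<in> charts_at M (chart_inv c y)"
  using assms chart_inv_in(1)[of y c] by (simp add: charts_at_def)

lemma linear_form_in_chart:
  assumes M: "smooth_manifold M" and \<theta>: "smooth_one_form M \<theta>"
    and c: "c \<in> atlas M" and y: "y \<in> snd c ` fst c"
  shows "linear (\<lambda>w. form_in_chart M \<theta> c w y)"
proof -
  let ?q = "chart_inv c y"
  have q: "c \<in> charts_at M ?q" by (rule chart_inv_charts_at[OF c y])
  have "linear_form_on (tangent_space M ?q) (\<theta> ?q)"
    using \<theta> charts_at_points[OF M q] unfolding smooth_one_form_def by blast
  then have lc: "form_in_chart M \<theta> c (a *\<^sub>R u + b *\<^sub>R w) y =
      a * form_in_chart M \<theta> c u y + b * form_in_chart M \<theta> c w y" for a b u w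
    unfolding form_in_chart_def coord_tvec_lincomb[OF M q] linear_form_on_def
    using coord_tvec_tangent[OF M q] by blast
  show ?thesis
    using lc[of 1 _ 1] lc[of _ _ 0] by (intro linearI) auto
qed

lemma form_in_chart_differentiable:
  assumes \<theta>: "smooth_one_form M \<theta>" and c: "c \<in> atlas M" and y: "y \<in> snd c ` fst c"
  shows "form_in_chart M \<theta> c w differentiable (at y)"
proof -
  have "smooth_on (snd c ` fst c) (form_in_chart M \<theta> c w)"
    using \<theta> c unfolding smooth_one_form_def form_in_chart_def by blast
  then show ?thesis using smooth_on_has_derivative[OF _ y] differentiableI by blast
qed

lemma one_form_eq_form_in_chart:
  assumes M: "smooth_manifold M" and c: "c \<in> charts_at M p" and v: "v \<in> tangent_space M p"
  shows "\<theta> p v = form_in_chart M \<theta> c (v c) (snd c p)"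
  unfolding form_in_chart_def chart_inv_chart[OF M charts_atD[OF c]] coord_tvec_component[OF M c v] ..

lemma ext_deriv_in_chart:
  assumes "c = chart_at M p"
  shows "ext_deriv M \<theta> p u v =
    frechet_derivative (form_in_chart M \<theta> c (v c)) (at (snd c p)) (u c)
    - frechet_derivative (form_in_chart M \<theta> c (u c)) (at (snd c p)) (v c)"
  unfolding assms ext_deriv_def form_in_chart_def Let_def ..

lemma finite_dimensional_model:
  fixes M :: "('p, 'e::real_normed_vector) manifold"
  assumes "smooth_manifold M"
  shows "finite_dimensional TYPE('e)"
  using assms unfolding smooth_manifold_def by blast

lemma has_derivative_form_in_chart:
  assumes M: "smooth_manifold M" and \<theta>: "smooth_one_form M \<theta>" and c: "c \<in> atlas M"
    and az: "a z \<in> snd c ` fst c"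
    and B: "(B has_derivative B') (at z)" and a: "(a has_derivative a') (at z)"
  shows "((\<lambda>x. form_in_chart M \<theta> c (B x) (a x)) has_derivative
    (\<lambda>\<zeta>. frechet_derivative (form_in_chart M \<theta> c (B z)) (at (a z)) (a' \<zeta>)
        + form_in_chart M \<theta> c (B' \<zeta>) (a z))) (at z)"
  by (rule has_derivative_linear_pairing[OF finite_dimensional_model[OF M] open_chart_range[OF M c] az
        linear_form_in_chart[OF M \<theta> c] form_in_chart_differentiable[OF \<theta> c az] B a])

text \<open>The condition \<open>F\<^sup>* \<beta> = \<alpha>\<close> for one-forms.\<close>

definition pullback_eq ::
  "('p, 'e::real_normed_vector) manifold \<Rightarrow> ('q, 'f::real_normed_vector) manifold \<Rightarrow> ('p \<Rightarrow> 'q) \<Rightarrow>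
   ('q \<Rightarrow> ('q, 'f) tvec \<Rightarrow> real) \<Rightarrow> ('p \<Rightarrow> ('p, 'e) tvec \<Rightarrow> real) \<Rightarrow> bool" where
  "pullback_eq M N F \<beta> \<alpha> \<longleftrightarrow>
     (\<forall>p\<in>points M. \<forall>v\<in>tangent_space M p. \<beta> (F p) (tangent_map M N F p v) = \<alpha> p v)"

lemma pullback_eq_in_charts:
  assumes M: "smooth_manifold M" and N: "smooth_manifold N" and F: "smooth_map M N F"
    and pb: "pullback_eq M N F \<beta> \<alpha>"
    and c: "c \<in> charts_at M p" and d: "d \<in> charts_at N (F p)"
  shows "form_in_chart N \<beta> d (frechet_derivative (snd d \<circ> F \<circ> chart_inv c) (at (snd c p)) w) (snd d (F p))
    = form_in_chart M \<alpha> c w (snd c p)"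
proof -
  let ?v = "coord_tvec M c p w"
  have p: "p \<in> points M" by (rule charts_at_points[OF M c])
  have v: "?v \<in> tangent_space M p" by (rule coord_tvec_tangent[OF M c])
  have "\<beta> (F p) (tangent_map M N F p ?v) = \<alpha> p ?v"
    using pb p v unfolding pullback_eq_def by blast
  then show ?thesis
    using one_form_eq_form_in_chart[OF M c v, of \<alpha>]
      one_form_eq_form_in_chart[OF N d tangent_map_tangent[OF M N F p], of \<beta> ?v]
      tangent_map_component[OF M N F v c d] coord_tvec_self[OF M c, of w] by simp
qed

text \<open>Naturality \<open>F\<^sup>* d\<beta> = d(F\<^sup>* \<beta>)\<close>. In charts, differentiating \<open>\<beta> (Dh(y) w) (h y) = \<alpha> w y\<close> in the
  direction \<open>w'\<close> gives the derivative of \<open>\<beta>\<close> evaluated at \<open>Dh w, Dh w'\<close> plus a term with the second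
  derivative of \<open>h\<close>; that term cancels under antisymmetrization.\<close>

lemma ext_deriv_pullback:
  assumes M: "smooth_manifold M" and N: "smooth_manifold N" and F: "smooth_map M N F"
    and \<alpha>: "smooth_one_form M \<alpha>" and \<beta>: "smooth_one_form N \<beta>"
    and pb: "pullback_eq M N F \<beta> \<alpha>"
    and p: "p \<in> points M" and u: "u \<in> tangent_space M p" and v: "v \<in> tangent_space M p"
  shows "ext_deriv N \<beta> (F p) (tangent_map M N F p u) (tangent_map M N F p v) = ext_deriv M \<alpha> p u v"
proof -
  define c where "c = chart_at M p"
  define d where "d = chart_at N (F p)"
  have c: "c \<in> charts_at M p" unfolding c_def by (rule chart_at_in[OF M p])
  have d: "d \<in> charts_at N (F p)"
    unfolding d_def by (rule chart_at_in[OF N smooth_map_in_points[OF F p]])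
  note cM = charts_atD(1)[OF c] and dN = charts_atD(1)[OF d]
  define h where "h = snd d \<circ> F \<circ> chart_inv c"
  define S where "S = snd c ` {q \<in> fst c. F q \<in> fst d}"
  define y0 where "y0 = snd c p"
  have S: "open S" and h: "smooth_on S h"
    unfolding S_def h_def by (rule smooth_map_local[OF M N F cM dN])+
  have y0: "y0 \<in> S" unfolding y0_def S_def using charts_atD(2)[OF c] charts_atD(2)[OF d] by blast
  have hy0: "h y0 = snd d (F p)"
    unfolding h_def y0_def by (simp add: chart_inv_chart[OF M charts_atD[OF c]])
  let ?D = "\<lambda>y. frechet_derivative h (at y)"
  let ?\<alpha> = "form_in_chart M \<alpha> c" and ?\<beta> = "form_in_chart N \<beta> d"
  have eq: "?\<beta> (?D y w) (h y) = ?\<alpha> w y" if y: "y \<in> S" for y w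
  proof -
    obtain q where q: "q \<in> fst c" "F q \<in> fst d" "y = snd c q" using y unfolding S_def by blast
    then have "c \<in> charts_at M q" "d \<in> charts_at N (F q)" using cM dN by (auto simp: charts_at_def)
    from pullback_eq_in_charts[OF M N F pb this, of w] q show ?thesis
      unfolding h_def by (simp add: chart_inv_chart[OF M cM q(1)])
  qed
  let ?D2 = "\<lambda>w. frechet_derivative (\<lambda>y. ?D y w) (at y0)"
  have D2: "((\<lambda>y. ?D y w) has_derivative ?D2 w) (at y0)" for w
    by (rule smooth_on_has_derivative[OF smooth_on_directional_derivative[OF h] y0])
  have sm: "?D2 w w' = ?D2 w' w" for w w'
    by (rule second_derivative_symmetric[OF S y0 smooth_on_has_derivative[OF h] D2 D2])
  have D\<alpha>: "frechet_derivative (?\<alpha> w) (at y0) w' =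
      frechet_derivative (?\<beta> (?D y0 w)) (at (h y0)) (?D y0 w') + ?\<beta> (?D2 w w') (h y0)" for w w'
  proof -
    have "h y0 \<in> snd d ` fst d" unfolding hy0 by (rule chart_point_in_range[OF d])
    from has_derivative_form_in_chart[where a = h, OF N \<beta> dN this D2 smooth_on_has_derivative[OF h y0]]
    have "((\<lambda>y. ?\<beta> (?D y w) (h y)) has_derivative
        (\<lambda>w'. frechet_derivative (?\<beta> (?D y0 w)) (at (h y0)) (?D y0 w') + ?\<beta> (?D2 w w') (h y0))) (at y0)" .
    from frechet_derivative_at[OF has_derivative_transform_within_open[OF this S y0 eq]]
    show ?thesis by (rule fun_cong[OF sym])
  qed
  have comp: "tangent_map M N F p w d = ?D y0 (w c)" if "w \<in> tangent_space M p" for w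
    unfolding h_def y0_def by (rule tangent_map_component[OF M N F that c d])
  show ?thesis
    unfolding ext_deriv_in_chart[OF c_def] ext_deriv_in_chart[OF d_def] comp[OF u] comp[OF v]
      hy0[symmetric] y0_def[symmetric] D\<alpha> using sm[of "u c" "v c"] by simp
qed

lemma ext_deriv_tlincomb_left:
  assumes M: "smooth_manifold M" and \<theta>: "smooth_one_form M \<theta>" and p: "p \<in> points M"
  shows "ext_deriv M \<theta> p (tlincomb a u b v) w = a * ext_deriv M \<theta> p u w + b * ext_deriv M \<theta> p v w"
proof -
  define c where "c = chart_at M p"
  have c: "c \<in> charts_at M p" unfolding c_def by (rule chart_at_in[OF M p])
  note cM = charts_atD(1)[OF c]
  let ?y = "snd c p" and ?\<Theta> = "form_in_chart M \<theta> c"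
  have y: "?y \<in> snd c ` fst c" by (rule chart_point_in_range[OF c])
  have d: "(?\<Theta> x has_derivative frechet_derivative (?\<Theta> x) (at ?y)) (at ?y)" for x
    using form_in_chart_differentiable[OF \<theta> cM y] frechet_derivative_works by blast
  interpret D: linear "frechet_derivative (?\<Theta> (w c)) (at ?y)"
    using d has_derivative_linear by blast
  have "((\<lambda>y. a * ?\<Theta> (u c) y + b * ?\<Theta> (v c) y) has_derivative
      (\<lambda>z. a * frechet_derivative (?\<Theta> (u c)) (at ?y) z + b * frechet_derivative (?\<Theta> (v c)) (at ?y) z))
      (at ?y)"
    by (intro has_derivative_add has_derivative_mult_right d)
  moreover have "a * ?\<Theta> (u c) y + b * ?\<Theta> (v c) y = ?\<Theta> (a *\<^sub>R u c + b *\<^sub>R v c) y"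
    if "y \<in> snd c ` fst c" for y
  proof -
    interpret linear "\<lambda>w. ?\<Theta> w y" by (rule linear_form_in_chart[OF M \<theta> cM that])
    show ?thesis by (simp add: add scale)
  qed
  ultimately have "(?\<Theta> (a *\<^sub>R u c + b *\<^sub>R v c) has_derivative
      (\<lambda>z. a * frechet_derivative (?\<Theta> (u c)) (at ?y) z + b * frechet_derivative (?\<Theta> (v c)) (at ?y) z))
      (at ?y)"
    by (rule has_derivative_transform_within_open[OF _ open_chart_range[OF M cM] y])
  from frechet_derivative_at[OF this, symmetric]
  have "frechet_derivative (?\<Theta> (a *\<^sub>R u c + b *\<^sub>R v c)) (at ?y) =
      (\<lambda>z. a * frechet_derivative (?\<Theta> (u c)) (at ?y) z + b * frechet_derivative (?\<Theta> (v c)) (at ?y) z)" .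
  then show ?thesis
    unfolding ext_deriv_in_chart[OF c_def] tlincomb_def by (simp add: D.add D.scale algebra_simps)
qed

section \<open>Cartan's formula for a symmetry of a one-form\<close>

text \<open>Let \<open>F (n, _)\<close> be a smooth family of maps preserving \<open>\<theta>\<close> with \<open>F (n0, _)\<close> the identity, and let
  \<open>Y\<close> be the infinitesimal generator belonging to a tangent vector \<open>\<eta>\<close> at \<open>n0\<close>. Then
  \<open>d(\<theta>(Y)) = - i\<^sub>Y d\<theta>\<close>, i.e. Cartan's formula \<open>L\<^sub>Y \<theta> = d(i\<^sub>Y \<theta>) + i\<^sub>Y d\<theta>\<close> with \<open>L\<^sub>Y \<theta> = 0\<close>. No flow
  of \<open>Y\<close> is needed: differentiating the invariance of \<open>\<theta>\<close> with respect to the parameter at \<open>n0\<close> gives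
  \<open>L\<^sub>Y \<theta> = 0\<close> in the chart, and the mixed second derivatives of \<open>F\<close> in the parameter and
  in the point are equal.\<close>

lemma one_form_generator_has_derivative:
  fixes N :: "('g, 'k::real_normed_vector) manifold" and M :: "('p, 'e::real_normed_vector) manifold"
  assumes N: "smooth_manifold N" and M: "smooth_manifold M"
    and F: "smooth_map (prod_manifold N M) M F" and \<theta>: "smooth_one_form M \<theta>"
    and n0: "n0 \<in> points N" and F0: "\<And>q. q \<in> points M \<Longrightarrow> F (n0, q) = q"
    and inv: "\<And>n. n \<in> points N \<Longrightarrow> pullback_eq M M (\<lambda>q. F (n, q)) \<theta> \<theta>"
    and \<eta>: "\<eta> \<in> tangent_space N n0"
    and p: "p \<in> points M" and c_def: "c = chart_at M p"
  defines "Y \<equiv> \<lambda>q. tangent_map N M (\<lambda>n. F (n, q)) n0 \<eta>"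
  shows "((\<lambda>y. \<theta> (chart_inv c y) (Y (chart_inv c y))) has_derivative
     (\<lambda>w. frechet_derivative (form_in_chart M \<theta> c (Y p c)) (at (snd c p)) w
        - frechet_derivative (form_in_chart M \<theta> c w) (at (snd c p)) (Y p c))) (at (snd c p))"
proof -
  have c: "c \<in> charts_at M p" unfolding c_def by (rule chart_at_in[OF M p])
  define k where "k = chart_at N n0"
  have k: "k \<in> charts_at N n0" unfolding k_def by (rule chart_at_in[OF N n0])
  note cM = charts_atD(1)[OF c] and kN = charts_atD(1)[OF k]
  let ?R = "snd c ` fst c" and ?\<Theta> = "form_in_chart M \<theta> c"
  define x0 where "x0 = snd k n0"
  define y0 where "y0 = snd c p"
  define e where "e = \<eta> k"
  define A where "A = (\<lambda>z. snd c (F (chart_inv k (fst z), chart_inv c (snd z))))"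
  define W where "W = {z \<in> (snd k ` fst k) \<times> ?R. F (chart_inv k (fst z), chart_inv c (snd z)) \<in> fst c}"
  have W: "open W" and A: "smooth_on W A"
    unfolding W_def A_def by (rule smooth_map_prod_local[OF N M M F kN cM cM])+
  have x0: "chart_inv k x0 = n0" unfolding x0_def by (rule chart_inv_chart[OF N charts_atD[OF k]])
  have R: "open ?R" by (rule open_chart_range[OF M cM])
  have y0: "y0 \<in> ?R" unfolding y0_def by (rule chart_point_in_range[OF c])
  have cy: "c \<in> charts_at M (chart_inv c y)" if "y \<in> ?R" for y
    by (rule chart_inv_charts_at[OF cM that])
  have py: "chart_inv c y \<in> points M" if "y \<in> ?R" for y
    by (rule charts_at_points[OF M cy[OF that]])
  have W0: "(x0, y) \<in> W" if y: "y \<in> ?R" for y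
    unfolding W_def using x0 F0[OF py[OF y]] chart_inv_in(1)[OF y] chart_point_in_range[OF k] y
    by (simp add: x0_def)
  have A0: "A (x0, y) = y" if y: "y \<in> ?R" for y
    unfolding A_def using x0 F0[OF py[OF y]] chart_inv_in(2)[OF y] by simp
  let ?D = "\<lambda>z. frechet_derivative A (at z)"
  have dA: "(A has_derivative ?D z) (at z)" if "z \<in> W" for z
    by (rule smooth_on_has_derivative[OF A that])
  have left: "((\<lambda>x. (x, y)) has_derivative (\<lambda>v. (v, 0))) (at x)" for x :: 'k and y :: 'e
    by (auto intro!: derivative_eq_intros)
  have right: "((\<lambda>y. (x, y)) has_derivative (\<lambda>v. (0, v))) (at y)" for x :: 'k and y :: 'e
    by (auto intro!: derivative_eq_intros)
  have dA_left: "((\<lambda>x'. A (x', y)) has_derivative (\<lambda>v. ?D (x, y) (v, 0))) (at x)"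
    if "(x, y) \<in> W" for x y
    using has_derivative_compose[OF left dA[OF that]] .
  have dA_right: "((\<lambda>y'. A (x, y')) has_derivative (\<lambda>v. ?D (x, y) (0, v))) (at y)"
    if "(x, y) \<in> W" for x y
    using has_derivative_compose[OF right dA[OF that]] .
  have Y: "Y (chart_inv c y) \<in> tangent_space M (chart_inv c y)"
    "Y (chart_inv c y) c = ?D (x0, y) (e, 0)" if y: "y \<in> ?R" for y
  proof -
    let ?q = "chart_inv c y"
    have s: "smooth_map N M (\<lambda>n. F (n, ?q))" by (rule smooth_map_slice_left[OF N M M F py[OF y]])
    have q0: "F (n0, ?q) = ?q" by (rule F0[OF py[OF y]])
    show "Y ?q \<in> tangent_space M ?q"
      using tangent_map_tangent[OF N M s n0, of \<eta>] unfolding Y_def q0 .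
    have "Y ?q c = frechet_derivative (snd c \<circ> (\<lambda>n. F (n, ?q)) \<circ> chart_inv k) (at x0) e"
      unfolding Y_def x0_def e_def
      using tangent_map_component[OF N M s \<eta> k, of c] cy[OF y] q0 by simp
    also have "snd c \<circ> (\<lambda>n. F (n, ?q)) \<circ> chart_inv k = (\<lambda>x. A (x, y))"
      by (simp add: A_def o_def)
    also have "frechet_derivative (\<lambda>x. A (x, y)) (at x0) = (\<lambda>v. ?D (x0, y) (v, 0))"
      using frechet_derivative_at[OF dA_left[OF W0[OF y]]] by simp
    finally show "Y ?q c = ?D (x0, y) (e, 0)" .
  qed
  have cp: "chart_inv c y0 = p" unfolding y0_def by (rule chart_inv_chart[OF M charts_atD[OF c]])
  have Yp: "Y p c = ?D (x0, y0) (e, 0)" using Y(2)[OF y0] cp by simp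
  have inv_A: "?\<Theta> (?D z (0, w)) (A z) = ?\<Theta> w (snd z)" if z: "z \<in> W" for z w
  proof -
    obtain x y where xy: "z = (x, y)" "x \<in> snd k ` fst k" "y \<in> ?R"
      and Fc: "F (chart_inv k x, chart_inv c y) \<in> fst c"
      using z unfolding W_def by (cases z) auto
    let ?n = "chart_inv k x" and ?q = "chart_inv c y"
    have n: "?n \<in> points N"
      by (rule charts_at_points[OF N chart_inv_charts_at[OF kN xy(2)]])
    have s: "smooth_map M M (\<lambda>q. F (?n, q))" by (rule smooth_map_slice_right[OF N M M F n])
    have d: "c \<in> charts_at M (F (?n, ?q))" using Fc cM by (simp add: charts_at_def)
    have "snd c \<circ> (\<lambda>q. F (?n, q)) \<circ> chart_inv c = (\<lambda>y. A (x, y))"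
      by (simp add: A_def o_def)
    moreover have "frechet_derivative (\<lambda>y. A (x, y)) (at y) = (\<lambda>v. ?D (x, y) (0, v))"
      by (rule frechet_derivative_at[OF dA_right, symmetric]) (use z xy(1) in simp)
    ultimately show ?thesis
      using pullback_eq_in_charts[OF M M s inv[OF n] cy[OF xy(3)] d, of w] chart_inv_in(2)[OF xy(3)]
      by (simp add: xy(1) A_def)
  qed
  have z0: "(x0, y0) \<in> W" by (rule W0[OF y0])
  let ?D2 = "\<lambda>u. frechet_derivative (\<lambda>z. ?D z u) (at (x0, y0))"
  have D2: "((\<lambda>z. ?D z u) has_derivative ?D2 u) (at (x0, y0))" for u
    by (rule smooth_on_has_derivative[OF smooth_on_directional_derivative[OF A] z0])
  have sm: "?D2 u v = ?D2 v u" for u v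
    by (rule second_derivative_symmetric[OF W z0 dA D2 D2])
  have Az0: "A (x0, y0) \<in> ?R" using A0[OF y0] y0 by simp
  have D0: "?D (x0, y0) (0, w) = w" for w
  proof -
    have "((\<lambda>y. y) has_derivative (\<lambda>v. ?D (x0, y0) (0, v))) (at y0)"
      by (rule has_derivative_transform_within_open[OF dA_right[OF z0] R y0 A0])
    from has_derivative_unique[OF this has_derivative_ident] show ?thesis by (rule fun_cong)
  qed
  \<comment> \<open>The coordinate form of \<open>L\<^sub>Y \<theta> = 0\<close>: the invariance \<open>inv_A\<close>, differentiated in the direction
    \<open>(e, 0)\<close> of the parameter.\<close>
  have key: "frechet_derivative (?\<Theta> w) (at y0) (Y p c) = - ?\<Theta> (?D2 (0, w) (e, 0)) y0" for w
  proof -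
    have "((\<lambda>z. ?\<Theta> (?D z (0, w)) (A z)) has_derivative
        (\<lambda>\<zeta>. frechet_derivative (?\<Theta> w) (at y0) (?D (x0, y0) \<zeta>) + ?\<Theta> (?D2 (0, w) \<zeta>) y0)) (at (x0, y0))"
      using has_derivative_form_in_chart[where a = A, OF M \<theta> cM Az0 D2[of "(0, w)"] dA[OF z0]]
      by (simp add: D0 A0[OF y0])
    then have 1: "((\<lambda>z. ?\<Theta> w (snd z)) has_derivative
        (\<lambda>\<zeta>. frechet_derivative (?\<Theta> w) (at y0) (?D (x0, y0) \<zeta>) + ?\<Theta> (?D2 (0, w) \<zeta>) y0)) (at (x0, y0))"
      by (rule has_derivative_transform_within_open[OF _ W z0 inv_A])
    have "(?\<Theta> w has_derivative frechet_derivative (?\<Theta> w) (at y0)) (at (snd (x0, y0)))"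
      using iffD1[OF frechet_derivative_works form_in_chart_differentiable[OF \<theta> cM y0]] by simp
    from has_derivative_compose[OF has_derivative_snd[OF has_derivative_ident] this]
    have 2: "((\<lambda>z. ?\<Theta> w (snd z)) has_derivative
        (\<lambda>\<zeta>. frechet_derivative (?\<Theta> w) (at y0) (snd \<zeta>))) (at (x0, y0))" .
    interpret l: linear "frechet_derivative (?\<Theta> w) (at y0)"
      using form_in_chart_differentiable[OF \<theta> cM y0] frechet_derivative_works has_derivative_linear by blast
    from fun_cong[OF has_derivative_unique[OF 1 2], of "(e, 0)"]
    show ?thesis unfolding Yp by (simp add: l.zero)
  qed
  have dB: "((\<lambda>y. ?D (x0, y) (e, 0)) has_derivative (\<lambda>w. ?D2 (e, 0) (0, w))) (at y0)"
    using has_derivative_compose[OF right D2] .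
  have "((\<lambda>y. ?\<Theta> (?D (x0, y) (e, 0)) y) has_derivative
      (\<lambda>w. frechet_derivative (?\<Theta> (Y p c)) (at y0) w + ?\<Theta> (?D2 (e, 0) (0, w)) y0)) (at y0)"
    using has_derivative_form_in_chart[where a = "\<lambda>y. y", OF M \<theta> cM y0 dB has_derivative_ident]
    unfolding Yp .
  then have "((\<lambda>y. \<theta> (chart_inv c y) (Y (chart_inv c y))) has_derivative
      (\<lambda>w. frechet_derivative (?\<Theta> (Y p c)) (at y0) w + ?\<Theta> (?D2 (e, 0) (0, w)) y0)) (at y0)"
  proof (rule has_derivative_transform_within_open[OF _ R y0])
    fix y assume y: "y \<in> ?R"
    show "?\<Theta> (?D (x0, y) (e, 0)) y = \<theta> (chart_inv c y) (Y (chart_inv c y))"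
      using one_form_eq_form_in_chart[OF M cy[OF y] Y(1)[OF y], of \<theta>] Y(2)[OF y] chart_inv_in(2)[OF y]
      by simp
  qed
  then show ?thesis
    unfolding y0_def[symmetric] key using sm by simp
qed

section \<open>Conformal Hamiltonian fields with symmetry\<close>

lemma smooth_fun_has_derivative:
  assumes h: "smooth_fun M h" and c: "c \<in> charts_at M p"
  shows "((h \<circ> chart_inv c) has_derivative frechet_derivative (h \<circ> chart_inv c) (at (snd c p)))
    (at (snd c p))"
  using h charts_atD(1)[OF c] smooth_on_has_derivative[OF _ chart_point_in_range[OF c]]
  unfolding smooth_fun_def by blast

lemma differential_pullback:
  assumes M: "smooth_manifold M" and N: "smooth_manifold N" and F: "smooth_map M N F"
    and h: "smooth_fun N h" and p: "p \<in> points M"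
    and c: "c = chart_at M p"
  shows "differential N h (F p) (tangent_map M N F p v) =
    frechet_derivative (h \<circ> F \<circ> chart_inv c) (at (snd c p)) (v c)"
proof -
  define d where "d = chart_at N (F p)"
  have c': "c \<in> charts_at M p" unfolding c by (rule chart_at_in[OF M p])
  have d: "d \<in> charts_at N (F p)"
    unfolding d_def by (rule chart_at_in[OF N smooth_map_in_points[OF F p]])
  let ?f = "snd d \<circ> F \<circ> chart_inv c"
  have fp: "?f (snd c p) = snd d (F p)" by (simp add: chart_inv_chart[OF M charts_atD[OF c']])
  have "(h \<circ> chart_inv d has_derivative frechet_derivative (h \<circ> chart_inv d) (at (snd d (F p))))
      (at (?f (snd c p)))"
    unfolding fp by (rule smooth_fun_has_derivative[OF h d])
  from diff_chain_at[OF smooth_map_has_derivative[OF M N F c' d] this]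
  have "((h \<circ> F \<circ> chart_inv c) has_derivative
     frechet_derivative (h \<circ> chart_inv d) (at (snd d (F p))) \<circ> frechet_derivative ?f (at (snd c p)))
     (at (snd c p))"
  proof (rule has_derivative_transform_within_open)
    show "open (snd c ` {q \<in> fst c. F q \<in> fst d})"
      by (rule smooth_map_local(1)[OF M N F charts_atD(1)[OF c'] charts_atD(1)[OF d]])
    show "snd c p \<in> snd c ` {q \<in> fst c. F q \<in> fst d}" using charts_atD(2)[OF c'] charts_atD(2)[OF d] by blast
    fix y assume "y \<in> snd c ` {q \<in> fst c. F q \<in> fst d}"
    then obtain q where q: "q \<in> fst c" "F q \<in> fst d" "y = snd c q" by blast
    then show "((h \<circ> chart_inv d) \<circ> ?f) y = (h \<circ> F \<circ> chart_inv c) y"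
      using chart_inv_chart[OF M charts_atD(1)[OF c'] q(1)] chart_inv_chart[OF N charts_atD(1)[OF d] q(2)]
      by simp
  qed
  from frechet_derivative_at[OF this, symmetric] show ?thesis
    using d unfolding differential_def tangent_map_def Let_def c[symmetric] d_def[symmetric] by simp
qed

text \<open>The interval integral is signed, so \<open>t\<close> may be negative.\<close>

lemma linear_ode_solution:
  fixes u a :: "real \<Rightarrow> real"
  assumes I: "is_interval I" "0 \<in> I" "t \<in> I"
    and a: "continuous_on I a"
    and u: "\<And>s. s \<in> I \<Longrightarrow> (u has_real_derivative a s * u s) (at s)"
  shows "u t = exp (LBINT s=0..ereal t. a s) * u 0"
proof -
  define K where "K = {min 0 t..max 0 t}"
  have KI: "K \<subseteq> I"
  proof
    fix s assume "s \<in> K"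
    then have s: "min 0 t \<le> s" "s \<le> max 0 t" by (auto simp: K_def)
    have "min 0 t \<in> I" "max 0 t \<in> I" using I(2,3) by (simp_all add: min_def max_def)
    then show "s \<in> I" using s by (rule mem_is_interval_1_I[OF I(1)])
  qed
  define A where "A = (\<lambda>x::real. LBINT s=ereal 0..ereal x. a s)"
  have dA: "(A has_real_derivative a s) (at s within K)" if "s \<in> K" for s
    unfolding A_def K_def has_real_derivative_iff_has_vector_derivative
    using that continuous_on_subset[OF a KI]
    by (intro interval_integral_FTC2) (auto simp: K_def)
  have "((\<lambda>s. u s * exp (- A s)) has_derivative (\<lambda>_. 0)) (at s within K)" if s: "s \<in> K" for s
  proof -
    have "(u has_real_derivative a s * u s) (at s within K)"
      using u KI s has_field_derivative_at_within by blast
    then have "((\<lambda>s. u s * exp (- A s)) has_real_derivative 0) (at s within K)"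
      using dA[OF s] by (auto intro!: derivative_eq_intros)
    then show ?thesis by (simp add: has_field_derivative_def lambda_zero)
  qed
  then have "u t * exp (- A t) = u 0 * exp (- A 0)"
    by (intro has_derivative_zero_unique[of K]) (auto simp: K_def)
  moreover have "A 0 = 0" by (simp add: A_def)
  ultimately have "u t = exp (A t) * u 0" by (simp add: exp_minus field_simps)
  then show ?thesis by (simp add: A_def zero_ereal_def)
qed

lemma Lie_group_action_facts:
  assumes G: "lie_group G MG" and act: "smooth_action G MG M \<Phi>" and M: "smooth_manifold M"
  shows Lie_group_manifold: "smooth_manifold MG"
    and one_in_Lie_group: "\<one>\<^bsub>G\<^esub> \<in> points MG"
    and Lie_group_points: "points MG = carrier G"
    and smooth_map_action_by: "\<And>g. g \<in> carrier G \<Longrightarrow> smooth_map M M (\<Phi> g)"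
    and action_one: "\<And>p. p \<in> points M \<Longrightarrow> \<Phi> \<one>\<^bsub>G\<^esub> p = p"
    and smooth_map_orbit: "\<And>p. p \<in> points M \<Longrightarrow> smooth_map MG M (\<lambda>g. \<Phi> g p)"
proof -
  show MG: "smooth_manifold MG" and pts: "points MG = carrier G"
    using G unfolding lie_group_def by auto
  interpret group G using G unfolding lie_group_def by blast
  show "\<one>\<^bsub>G\<^esub> \<in> points MG" unfolding pts by simp
  have F: "smooth_map (prod_manifold MG M) M (\<lambda>(g, p). \<Phi> g p)"
    using act unfolding smooth_action_def by blast
  interpret group_action G "points M" \<Phi> using act unfolding smooth_action_def by blast
  show "smooth_map M M (\<Phi> g)" if "g \<in> carrier G" for g
    using smooth_map_slice_right[OF MG M M F, of g] that pts by simp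
  show "smooth_map MG M (\<lambda>g. \<Phi> g p)" if "p \<in> points M" for p
    using smooth_map_slice_left[OF MG M M F that] by simp
  show "\<Phi> \<one>\<^bsub>G\<^esub> p = p" if "p \<in> points M" for p
    using fun_cong[OF id_eq_one, of p] that by simp
qed

text \<open>Both \<open>X (\<Phi> g p)\<close> and the image of \<open>X p\<close> under the tangent map of \<open>\<Phi> g\<close> satisfy the defining equation
  of the conformal Hamiltonian field at \<open>\<Phi> g p\<close>, which has only one solution as \<open>-d\<theta>\<close> is
  nondegenerate.\<close>

lemma conformal_hamiltonian_field_invariant:
  assumes G: "lie_group G MG" and ex: "exact_symplectic_manifold M \<theta>"
    and act: "smooth_action G MG M \<Phi>" and inv: "invariant_one_form G M \<Phi> \<theta>"
    and H: "smooth_fun M H" "invariant_fun G M \<Phi> H" and f: "invariant_fun G M \<Phi> f"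
    and X: "conformal_hamiltonian_field M \<theta> f H X"
  shows "invariant_vector_field G M \<Phi> X"
  unfolding invariant_vector_field_def
proof (intro ballI)
  fix g p assume g: "g \<in> carrier G" and p: "p \<in> points M"
  have M: "smooth_manifold M" and \<theta>: "smooth_one_form M \<theta>"
    using ex unfolding exact_symplectic_manifold_def by auto
  interpret group G using G unfolding lie_group_def by blast
  interpret group_action G "points M" \<Phi> using act unfolding smooth_action_def by blast
  note smooth = smooth_map_action_by[OF G act M]
  let ?T = "tangent_map M M (\<Phi> g) p" and ?q = "\<Phi> g p"
  have q: "?q \<in> points M" by (rule smooth_map_in_points[OF smooth[OF g] p])
  have pb: "pullback_eq M M (\<Phi> g) \<theta> \<theta>"
    using inv g unfolding invariant_one_form_def pullback_eq_def by blast
  have Xt: "X r \<in> tangent_space M r" if "r \<in> points M" for r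
    using X that unfolding conformal_hamiltonian_field_def smooth_vector_field_def by blast
  have Xeq: "minus_d M \<theta> r (X r) v = differential M H r v - f r * \<theta> r v"
    if "r \<in> points M" "v \<in> tangent_space M r" for r v
    using X that unfolding conformal_hamiltonian_field_def interior_product_def by blast
  have T: "?T v \<in> tangent_space M ?q" for v by (rule tangent_map_tangent[OF M M smooth[OF g] p])
  have dH: "differential M H ?q (?T v) = differential M H p v" for v
  proof -
    define c where "c = chart_at M p"
    have c: "c \<in> charts_at M p" unfolding c_def by (rule chart_at_in[OF M p])
    note cM = charts_atD(1)[OF c]
    have "(H \<circ> \<Phi> g \<circ> chart_inv c has_derivative frechet_derivative (H \<circ> chart_inv c) (at (snd c p)))
        (at (snd c p))"
    proof (rule has_derivative_transform_within_open[OF smooth_fun_has_derivative[OF H(1) c]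
          open_chart_range[OF M cM] chart_point_in_range[OF c]])
      fix y assume y: "y \<in> snd c ` fst c"
      have "chart_inv c y \<in> points M" by (rule charts_at_points[OF M chart_inv_charts_at[OF cM y]])
      then show "(H \<circ> chart_inv c) y = (H \<circ> \<Phi> g \<circ> chart_inv c) y"
        using H(2) g unfolding invariant_fun_def by simp
    qed
    from frechet_derivative_at[OF this]
      differential_pullback[OF M M smooth[OF g] H(1) p c_def, of v]
    show ?thesis unfolding differential_def Let_def c_def[symmetric] by simp
  qed
  have "minus_d M \<theta> ?q (tlincomb 1 (X ?q) (-1) (?T (X p))) w = 0" if w: "w \<in> tangent_space M ?q" for w
  proof -
    have g': "inv\<^bsub>G\<^esub> g \<in> carrier G" using g by simp
    have gg: "\<Phi> (inv\<^bsub>G\<^esub> g) ?q = p" by (rule orbit_sym_aux[OF g p refl])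
    have "\<Phi> g (\<Phi> (inv\<^bsub>G\<^esub> g) r) = r" if "r \<in> points M" for r
      using orbit_sym_aux[OF g' that refl] g by simp
    \<comment> \<open>The tangent map of \<open>\<Phi> g\<close> is onto, so the equation need only be tested on image vectors.\<close>
    from tangent_map_left_inverse[OF M M smooth[OF g'] smooth[OF g] this q w]
    obtain v where v: "w = ?T v" "v = tangent_map M M (\<Phi> (inv\<^bsub>G\<^esub> g)) ?q w"
      unfolding gg by auto
    have vt: "v \<in> tangent_space M p"
      using tangent_map_tangent[OF M M smooth[OF g'] q, of w] v(2) unfolding gg by simp
    have "minus_d M \<theta> ?q (X ?q) (?T v) = differential M H ?q (?T v) - f ?q * \<theta> ?q (?T v)"
      by (rule Xeq[OF q T])
    also have "\<dots> = differential M H p v - f p * \<theta> p v"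
      using dH pb p vt f g unfolding pullback_eq_def invariant_fun_def by simp
    also have "\<dots> = minus_d M \<theta> p (X p) v" by (rule Xeq[OF p vt, symmetric])
    also have "\<dots> = minus_d M \<theta> ?q (?T (X p)) (?T v)"
      unfolding minus_d_def ext_deriv_pullback[OF M M smooth[OF g] \<theta> \<theta> pb p Xt[OF p] vt] ..
    finally show ?thesis
      unfolding minus_d_def ext_deriv_tlincomb_left[OF M \<theta> q] v(1)[symmetric] by simp
  qed
  moreover have "tlincomb 1 (X ?q) (-1) (?T (X p)) \<in> tangent_space M ?q"
    by (rule tlincomb_tangent[OF M Xt[OF q] T])
  ultimately have "tlincomb 1 (X ?q) (-1) (?T (X p)) = (\<lambda>_. 0)"
    using ex q unfolding exact_symplectic_manifold_def by blast
  then show "X ?q = ?T (X p)"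
    by (simp add: tlincomb_def fun_eq_iff)
qed

text \<open>Along an integral curve, every component of the momentum satisfies \<open>j' = f j\<close>: by Cartan's
  formula \<open>dj(X) = d\<theta>(X, \<xi>\<^sub>M) = - \<omega>(X, \<xi>\<^sub>M)\<close>, which equals \<open>f \<theta>(\<xi>\<^sub>M) - dH(\<xi>\<^sub>M)\<close>, and \<open>dH(\<xi>\<^sub>M) = 0\<close> because \<open>H\<close> is
  constant on orbits.\<close>

lemma momentum_has_derivative_along_integral_curve:
  assumes G: "lie_group G MG" and ex: "exact_symplectic_manifold M \<theta>"
    and act: "smooth_action G MG M \<Phi>" and inv: "invariant_one_form G M \<Phi> \<theta>"
    and H: "smooth_fun M H" "invariant_fun G M \<Phi> H"
    and X: "conformal_hamiltonian_field M \<theta> f H X"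
    and x: "integral_curve M X I x" and s: "s \<in> I" and \<xi>: "\<xi> \<in> lie_algebra G MG"
  defines "j \<equiv> \<lambda>p. \<theta> p (generator G MG M \<Phi> \<xi> p)"
  shows "((\<lambda>t. j (x t)) has_real_derivative f (x s) * j (x s)) (at s)"
proof -
  have M: "smooth_manifold M" and \<theta>: "smooth_one_form M \<theta>"
    using ex unfolding exact_symplectic_manifold_def by auto
  note MG = Lie_group_manifold[OF G act M] and one = one_in_Lie_group[OF G act M]
  have F: "smooth_map (prod_manifold MG M) M (\<lambda>(g, p). \<Phi> g p)"
    using act unfolding smooth_action_def by blast
  have Iopen: "open I" and xc: "continuous_map (top_of_set I) (mtop M) x"
    using x unfolding integral_curve_def by auto
  define p where "p = x s"
  have p: "p \<in> points M" unfolding p_def using continuous_map_image_subset_topspace[OF xc] s by auto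
  define c where "c = chart_at M p"
  have c: "c \<in> charts_at M p" unfolding c_def by (rule chart_at_in[OF M p])
  note cM = charts_atD(1)[OF c]
  let ?Y = "generator G MG M \<Phi> \<xi>" and ?\<Theta> = "form_in_chart M \<theta> c"
  have pb: "pullback_eq M M (\<Phi> g) \<theta> \<theta>" if "g \<in> points MG" for g
    using inv that Lie_group_points[OF G act M]
    unfolding invariant_one_form_def pullback_eq_def by blast
  have "((\<lambda>y. j (chart_inv c y)) has_derivative
     (\<lambda>w. frechet_derivative (?\<Theta> (?Y p c)) (at (snd c p)) w
        - frechet_derivative (?\<Theta> w) (at (snd c p)) (?Y p c))) (at (snd c p))"
    using one_form_generator_has_derivative[OF MG M F \<theta> one _ _ \<xi> p c_def]
      action_one[OF G act M] pb
    unfolding j_def generator_def by simp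
  then have dj: "((\<lambda>y. j (chart_inv c y)) has_derivative
     (\<lambda>w. frechet_derivative (?\<Theta> (?Y p c)) (at (snd c p)) w
        - frechet_derivative (?\<Theta> w) (at (snd c p)) (?Y p c))) (at ((snd c \<circ> x) s))"
    by (simp add: p_def)
  have dx: "((snd c \<circ> x) has_derivative (\<lambda>h. h *\<^sub>R X p c)) (at s)"
    using x s c unfolding integral_curve_def p_def has_vector_derivative_def by blast
  let ?U = "{t \<in> I. x t \<in> fst c}"
  have "openin (top_of_set I) {t \<in> topspace (top_of_set I). x t \<in> fst c}"
    by (rule openin_continuous_map_preimage[OF xc openin_chart_domain[OF M cM]])
  then have U: "open ?U" using openin_open_trans[OF _ Iopen] by simp
  let ?L = "\<lambda>h. frechet_derivative (?\<Theta> (?Y p c)) (at (snd c p)) (h *\<^sub>R X p c)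
        - frechet_derivative (?\<Theta> (h *\<^sub>R X p c)) (at (snd c p)) (?Y p c)"
  have L: "((\<lambda>t. j (x t)) has_derivative ?L) (at s)"
    by (rule has_derivative_transform_within_open[OF has_derivative_compose[OF dx dj] U])
      (use s charts_atD(2)[OF c] chart_inv_chart[OF M cM] in \<open>auto simp: p_def\<close>)
  have "((\<lambda>t. j (x t)) has_real_derivative ?L 1) (at s)"
  proof (rule has_derivative_imp_has_field_derivative[OF L])
    show "h * ?L 1 = ?L h" for h
      using linear_scale[OF has_derivative_linear[OF L], of h 1] by simp
  qed
  moreover have "?L 1 = ext_deriv M \<theta> p (X p) (?Y p)"
    unfolding ext_deriv_in_chart[OF c_def] by simp
  moreover have "ext_deriv M \<theta> p (X p) (?Y p) = f p * j p"
  proof -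
    note orb = smooth_map_orbit[OF G act M p] and p1 = action_one[OF G act M p]
    have Yt: "?Y p \<in> tangent_space M p"
      using tangent_map_tangent[OF MG M orb one, of \<xi>] unfolding generator_def p1 .
    define k where "k = chart_at MG \<one>\<^bsub>G\<^esub>"
    have k: "k \<in> charts_at MG \<one>\<^bsub>G\<^esub>" unfolding k_def by (rule chart_at_in[OF MG one])
    have "((\<lambda>y. H p) has_derivative (\<lambda>_. 0)) (at (snd k \<one>\<^bsub>G\<^esub>))" by simp
    then have "(H \<circ> (\<lambda>g. \<Phi> g p) \<circ> chart_inv k has_derivative (\<lambda>_. 0)) (at (snd k \<one>\<^bsub>G\<^esub>))"
    proof (rule has_derivative_transform_within_open[OF _ open_chart_range[OF MG charts_atD(1)[OF k]]
          chart_point_in_range[OF k]])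
      fix y assume y: "y \<in> snd k ` fst k"
      have "chart_inv k y \<in> carrier G"
        using charts_at_points[OF MG chart_inv_charts_at[OF charts_atD(1)[OF k] y]]
          Lie_group_points[OF G act M] by simp
      then show "H p = (H \<circ> (\<lambda>g. \<Phi> g p) \<circ> chart_inv k) y"
        using H(2) p unfolding invariant_fun_def by simp
    qed
    from frechet_derivative_at[OF this, symmetric]
      differential_pullback[OF MG M orb H(1) one k_def, of \<xi>]
    have "differential M H p (?Y p) = 0" unfolding generator_def p1 by simp
    moreover have "minus_d M \<theta> p (X p) (?Y p) = differential M H p (?Y p) - f p * \<theta> p (?Y p)"
      using X p Yt unfolding conformal_hamiltonian_field_def interior_product_def by blast
    ultimately show ?thesis unfolding minus_d_def j_def by simp
  qed
  ultimately show ?thesis unfolding p_def by simp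
qed

lemma continuous_on_smooth_fun_curve:
  assumes M: "smooth_manifold M" and f: "smooth_fun M f" and x: "integral_curve M X I x"
  shows "continuous_on I (\<lambda>s. f (x s))"
proof (rule continuous_at_imp_continuous_on, rule ballI)
  fix s assume s: "s \<in> I"
  have Iopen: "open I" and xc: "continuous_map (top_of_set I) (mtop M) x"
    using x unfolding integral_curve_def by auto
  have p: "x s \<in> points M" using continuous_map_image_subset_topspace[OF xc] s by auto
  define c where "c = chart_at M (x s)"
  have c: "c \<in> charts_at M (x s)" unfolding c_def by (rule chart_at_in[OF M p])
  note cM = charts_atD(1)[OF c]
  have dx: "((snd c \<circ> x) has_derivative (\<lambda>h. h *\<^sub>R X (x s) c)) (at s)"
    using x s c unfolding integral_curve_def has_vector_derivative_def by blast
  have df: "((f \<circ> chart_inv c) has_derivative frechet_derivative (f \<circ> chart_inv c) (at (snd c (x s))))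
      (at ((snd c \<circ> x) s))"
    using smooth_fun_has_derivative[OF f c] by simp
  have "openin (top_of_set I) {t \<in> topspace (top_of_set I). x t \<in> fst c}"
    by (rule openin_continuous_map_preimage[OF xc openin_chart_domain[OF M cM]])
  then have U: "open {t \<in> I. x t \<in> fst c}" using openin_open_trans[OF _ Iopen] by simp
  from has_derivative_transform_within_open[OF diff_chain_at[OF dx df] this, of "\<lambda>s. f (x s)"]
  have "((\<lambda>s. f (x s)) has_derivative
      frechet_derivative (f \<circ> chart_inv c) (at (snd c (x s))) \<circ> (\<lambda>h. h *\<^sub>R X (x s) c)) (at s)"
    using s charts_atD(2)[OF c] chart_inv_chart[OF M cM] by simp
  then show "isCont (\<lambda>s. f (x s)) s" by (rule has_derivative_continuous)
qed

theorem proposition4p2: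
  fixes G :: "('g, 'z) monoid_scheme"
    and MG :: "('g, 'k::real_normed_vector) manifold"
    and M :: "('p, 'e::real_normed_vector) manifold"
    and \<Phi> :: "'g \<Rightarrow> 'p \<Rightarrow> 'p"
    and \<theta> :: "'p \<Rightarrow> ('p, 'e) tvec \<Rightarrow> real"
    and H f :: "'p \<Rightarrow> real"
    and X :: "'p \<Rightarrow> ('p, 'e) tvec"
    and J :: "'p \<Rightarrow> ('g, 'k) tvec \<Rightarrow> real"
  assumes "lie_group G MG"
    and "exact_symplectic_manifold M \<theta>"
    and "smooth_action G MG M \<Phi>"
    and "invariant_one_form G M \<Phi> \<theta>"
    and "smooth_fun M H" and "invariant_fun G M \<Phi> H"
    and "smooth_fun M f" and "invariant_fun G M \<Phi> f"
    and "J = momentum_map G MG M \<Phi> \<theta>"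
    and "conformal_hamiltonian_field M \<theta> f H X"
  shows "invariant_vector_field G M \<Phi> X \<and>
    (\<forall>I x t. integral_curve M X I x \<and> t \<in> I \<longrightarrow>
       J (x t) = dual_scale (exp (LBINT s=0..ereal t. f (x s))) (J (x 0)) \<and>
       (\<forall>\<mu>\<in>lie_dual G MG. x 0 \<in> ray_preimage M J \<mu> \<longrightarrow> x t \<in> ray_preimage M J \<mu>))"
proof (intro conjI allI impI ballI)
  have M: "smooth_manifold M"
    using assms(2) unfolding exact_symplectic_manifold_def by blast
  show "invariant_vector_field G M \<Phi> X"
    by (rule conformal_hamiltonian_field_invariant[OF assms(1-6) assms(8,10)])
  fix I x t assume *: "integral_curve M X I x \<and> t \<in> I"
  then have x: "integral_curve M X I x" and t: "t \<in> I" by auto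
  have I: "is_interval I" "0 \<in> I" and xc: "continuous_map (top_of_set I) (mtop M) x"
    using x unfolding integral_curve_def by auto
  let ?r = "exp (LBINT s=0..ereal t. f (x s))"
  show J: "J (x t) = dual_scale ?r (J (x 0))"
  proof (rule ext)
    fix \<xi>
    show "J (x t) \<xi> = dual_scale ?r (J (x 0)) \<xi>"
    proof (cases "\<xi> \<in> lie_algebra G MG")
      case True
      have "\<theta> (x t) (generator G MG M \<Phi> \<xi> (x t)) = ?r * \<theta> (x 0) (generator G MG M \<Phi> \<xi> (x 0))"
        by (rule linear_ode_solution[where u = "\<lambda>s. \<theta> (x s) (generator G MG M \<Phi> \<xi> (x s))",
              OF I t continuous_on_smooth_fun_curve[OF M assms(7) x]
                momentum_has_derivative_along_integral_curve[OF assms(1-6,10) x _ True]])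
      then show ?thesis using True by (simp add: assms(9) momentum_map_def dual_scale_def)
    qed (simp add: assms(9) momentum_map_def dual_scale_def)
  qed
  show "x t \<in> ray_preimage M J \<mu>" if x0: "x 0 \<in> ray_preimage M J \<mu>" for \<mu>
  proof -
    obtain r where r: "r > 0" "J (x 0) = dual_scale r \<mu>"
      using x0 unfolding ray_preimage_def ray_def by blast
    have "J (x t) = dual_scale (?r * r) \<mu>"
      unfolding J r(2) by (simp add: dual_scale_def mult.assoc)
    moreover have "?r * r > 0" using r(1) by simp
    moreover have "x t \<in> points M" using continuous_map_image_subset_topspace[OF xc] t by auto
    ultimately show ?thesis unfolding ray_preimage_def ray_def by blast
  qed
qed

end
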